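(* Let $X$ be a Peano continuum, $y_0\in X$, $\{x_j\}_{j\in\mathbb{N}}$ a sequence in $X$, $(A_j,a_j)$ ($j\in\mathbb{N}$) based spaces, and $Y=\operatorname{\bf Adj}(X,x_j,A_j,a_j)$. Then for all $n\geq 2$, the canonical homomorphism \[\Psi:\pi_n(Y,y_0)\to \pi_n(X,y_0)\oplus\prod_{j\in\mathbb{N}}\pi_n(A_j,a_j),\qquad \Psi([f])=([r\circ f],[r_1\circ f],[r_2\circ f],\dots)\] is a split epimorphism.
   Context: All spaces Hausdorff; Peano continuum = connected, locally path-connected compact metric space. $\operatorname{\bf Adj}(X,x_j,A_j,a_j)$: $Y_k$ is the adjunction space obtained from $X\sqcup A_1\sqcup\dots\sqcup A_k$ by identifying $a_j\sim x_j$ ($j\le k$), $\rho_{k+1,k}:Y_{k+1}\to Y_k$ collapses $A_{k+1}$ to $x_{k+1}$, and the space is $\varprojlim_k Y_k$ with subspace topology in $\prod_kY_k$; its underlying set is $(X\sqcup\coprod_jA_j)/(a_j\sim x_j)$. $r:Y\to X$ is the retraction collapsing each $A_j$ to $x_j$; $r_j:Y\to A_j$ is the retraction collapsing $X$ and all $A_i$, $i\ne j$, to $a_j$. *)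

theory Defs
  imports "HOL-Analysis.Analysis" "HOL-Algebra.Product_Groups"
begin

definition peano_continuum :: "'a topology \<Rightarrow> bool" where
  "peano_continuum X \<longleftrightarrow> metrizable_space X \<and> compact_space X \<and> connected_space X
      \<and> locally_path_connected_space X"

definition cube :: "nat \<Rightarrow> (nat \<Rightarrow> real) topology" where
  "cube n = product_topology (\<lambda>i. top_of_set {0..1}) {..<n}"

definition cube_bdry :: "nat \<Rightarrow> (nat \<Rightarrow> real) set" where
  "cube_bdry n = {t \<in> topspace (cube n). \<exists>i<n. t i = 0 \<or> t i = 1}"

definition hclass :: "nat \<Rightarrow> 'a topology \<Rightarrow> 'a \<Rightarrow> ((nat \<Rightarrow> real) \<Rightarrow> 'a)
                        \<Rightarrow> ((nat \<Rightarrow> real) \<Rightarrow> 'a) set" where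
  "hclass n Z z f = {g. homotopic_with (\<lambda>h. h ` cube_bdry n \<subseteq> {z}) (cube n) Z f g}"

definition cube_concat :: "((nat \<Rightarrow> real) \<Rightarrow> 'a) \<Rightarrow> ((nat \<Rightarrow> real) \<Rightarrow> 'a) \<Rightarrow> (nat \<Rightarrow> real) \<Rightarrow> 'a" where
  "cube_concat f g = (\<lambda>t. if t 0 \<le> 1/2 then f (t(0 := 2 * t 0)) else g (t(0 := 2 * t 0 - 1)))"

definition homotopy_group :: "nat \<Rightarrow> 'a topology \<Rightarrow> 'a \<Rightarrow> ((nat \<Rightarrow> real) \<Rightarrow> 'a) set monoid" where
  "homotopy_group n Z z =
    \<lparr> carrier = {hclass n Z z f | f. continuous_map (cube n) Z f \<and> f ` cube_bdry n \<subseteq> {z}},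
      mult = (\<lambda>C D. hclass n Z z (cube_concat (SOME f. f \<in> C) (SOME g. g \<in> D))),
      one = hclass n Z z (\<lambda>t. z) \<rparr>"

definition induced_hom :: "nat \<Rightarrow> 'b topology \<Rightarrow> 'b \<Rightarrow> ('a \<Rightarrow> 'b)
      \<Rightarrow> ((nat \<Rightarrow> real) \<Rightarrow> 'a) set \<Rightarrow> ((nat \<Rightarrow> real) \<Rightarrow> 'b) set" where
  "induced_hom n W w \<phi> C = hclass n W w (\<phi> \<circ> (SOME f. f \<in> C))"

text \<open>Points of the finite stages are represented in the type 'a + nat * 'b:
  Inl x for x in X and Inr (j, b) for b a point of A_j (indices j start at 0).
  The stage Y_k contains A_0, ..., A_(k-1).\<close>

definition disj_sum_top :: "'a topology \<Rightarrow> (nat \<Rightarrow> 'b topology) \<Rightarrow> nat \<Rightarrow> ('a + nat \<times> 'b) topology" where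
  "disj_sum_top X A k = topology (\<lambda>U.
      U \<subseteq> Inl ` topspace X \<union> (\<Union>j<k. (\<lambda>b. Inr (j, b)) ` topspace (A j))
      \<and> openin X {x. Inl x \<in> U} \<and> (\<forall>j<k. openin (A j) {b. Inr (j, b) \<in> U}))"

definition quotient_top :: "'a topology \<Rightarrow> ('a \<Rightarrow> 'b) \<Rightarrow> 'b topology" where
  "quotient_top T q = topology (\<lambda>U. U \<subseteq> q ` topspace T \<and> openin T {x \<in> topspace T. q x \<in> U})"

definition adj_quot :: "(nat \<Rightarrow> 'a) \<Rightarrow> (nat \<Rightarrow> 'b) \<Rightarrow> ('a + nat \<times> 'b) \<Rightarrow> ('a + nat \<times> 'b)" where
  "adj_quot x a p = (case p of Inl y \<Rightarrow> Inl y
                     | Inr (j, b) \<Rightarrow> if b = a j then Inl (x j) else Inr (j, b))"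

definition adj_stage :: "'a topology \<Rightarrow> (nat \<Rightarrow> 'a) \<Rightarrow> (nat \<Rightarrow> 'b topology) \<Rightarrow> (nat \<Rightarrow> 'b)
                          \<Rightarrow> nat \<Rightarrow> ('a + nat \<times> 'b) topology" where
  "adj_stage X x A a k = quotient_top (disj_sum_top X A k) (adj_quot x a)"

definition adj_bond :: "(nat \<Rightarrow> 'a) \<Rightarrow> nat \<Rightarrow> ('a + nat \<times> 'b) \<Rightarrow> ('a + nat \<times> 'b)" where
  "adj_bond x k p = (case p of Inl y \<Rightarrow> Inl y
                     | Inr (j, b) \<Rightarrow> if j = k then Inl (x k) else Inr (j, b))"

definition Adj :: "'a topology \<Rightarrow> (nat \<Rightarrow> 'a) \<Rightarrow> (nat \<Rightarrow> 'b topology) \<Rightarrow> (nat \<Rightarrow> 'b)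
                     \<Rightarrow> (nat \<Rightarrow> 'a + nat \<times> 'b) topology" where
  "Adj X x A a = subtopology (product_topology (adj_stage X x A a) UNIV)
      {y \<in> topspace (product_topology (adj_stage X x A a) UNIV). \<forall>k. y k = adj_bond x k (y (Suc k))}"

definition adj_incl :: "'a \<Rightarrow> (nat \<Rightarrow> 'a + nat \<times> 'b)" where
  "adj_incl y = (\<lambda>k. Inl y)"

text \<open>r : Y -> X, collapsing each A_j to x_j (projection to Y_0 = X).\<close>

definition adj_r :: "(nat \<Rightarrow> 'a + nat \<times> 'b) \<Rightarrow> 'a" where
  "adj_r y = projl (y 0)"

definition adj_rj :: "(nat \<Rightarrow> 'b) \<Rightarrow> nat \<Rightarrow> (nat \<Rightarrow> 'a + nat \<times> 'b) \<Rightarrow> 'b" where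
  "adj_rj a j y = (case y (Suc j) of Inl _ \<Rightarrow> a j
                   | Inr (i, b) \<Rightarrow> if i = j then b else a j)"

definition adj_Psi :: "nat \<Rightarrow> 'a topology \<Rightarrow> 'a \<Rightarrow> (nat \<Rightarrow> 'b topology) \<Rightarrow> (nat \<Rightarrow> 'b)
     \<Rightarrow> ((nat \<Rightarrow> real) \<Rightarrow> (nat \<Rightarrow> 'a + nat \<times> 'b)) set
     \<Rightarrow> ((nat \<Rightarrow> real) \<Rightarrow> 'a) set \<times> (nat \<Rightarrow> ((nat \<Rightarrow> real) \<Rightarrow> 'b) set)" where
  "adj_Psi n X y0 A a C =
     (induced_hom n X y0 adj_r C, \<lambda>j. induced_hom n (A j) (a j) (adj_rj a j) C)"

end

theory Submission
  imports Defs
begin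

text \<open>
  A point of \<open>Y\<close> is determined by its images under the retractions to \<open>X\<close> and the \<open>A j\<close>, and a map
  into \<open>Y\<close> is continuous as soon as its composites with these retractions are. So a map into \<open>Y\<close> is a
  map \<open>H\<close> into \<open>X\<close> together with maps \<open>G j\<close> into \<open>A j\<close> with disjoint supports, such that \<open>H = x j\<close> on the
  support of \<open>G j\<close>; no smallness of the \<open>G j\<close> is required.

  Since \<open>X\<close> is a Peano continuum there is a path \<open>\<beta>\<close> from \<open>y0\<close> that rests at \<open>x j\<close> during an open interval
  \<open>J j\<close>, the intervals being pairwise disjoint. Given \<open>f\<close> on \<open>X\<close> and \<open>g j\<close> on \<open>A j\<close>, put \<open>f\<close> on the half
  \<open>t 1 \<le> 1/2\<close> of the cube; on the other half let \<open>H\<close> run along \<open>\<beta>\<close> in direction \<open>1\<close> (contracted to \<open>y0\<close>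
  towards the boundary, hence null-homotopic) and place \<open>g j\<close> in a box over \<open>J j\<close>. This defines the
  splitting. It is multiplicative because the group operation concatenates in direction \<open>0\<close>, along
  which \<open>\<beta>\<close> is constant: the wall between two factors can be removed for all \<open>j\<close> simultaneously.
\<close>

section \<open>Paths resting at a given sequence\<close>

text \<open>Compactness gives a Lebesgue number for the cover by path connected open sets lying in
  balls of radius \<open>\<epsilon>/2\<close>. Two points closer than that number share a member of
  the cover, and a path inside it stays within \<open>\<epsilon>\<close> of its start.\<close>

lemma (in Metric_space) uniformly_locally_path_connected:
  assumes "compact_space mtopology" "locally_path_connected_space mtopology" "0 < \<epsilon>"
  obtains \<delta> where "0 < \<delta>"
    "\<And>p q. \<lbrakk>p \<in> M; q \<in> M; d p q < \<delta>\<rbrakk> \<Longrightarrow>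
       \<exists>\<gamma>. pathin mtopology \<gamma> \<and> \<gamma> 0 = p \<and> \<gamma> 1 = q \<and> (\<forall>t\<in>{0..1}. d p (\<gamma> t) \<le> \<epsilon>)"
proof -
  define \<C> where "\<C> = {U. openin mtopology U \<and> path_connectedin mtopology U \<and> (\<exists>c\<in>M. U \<subseteq> mball c (\<epsilon>/2))}"
  have cover: "M \<subseteq> \<Union>\<C>"
  proof
    fix p assume p: "p \<in> M"
    have "openin mtopology (mball p (\<epsilon>/2))" "p \<in> mball p (\<epsilon>/2)"
      using p assms(3) by auto
    then obtain U where "openin mtopology U" "path_connectedin mtopology U" "p \<in> U" "U \<subseteq> mball p (\<epsilon>/2)"
      using assms(2) unfolding locally_path_connected_space by metis
    with p show "p \<in> \<Union>\<C>" unfolding \<C>_def by blast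
  qed
  have "compactin mtopology M"
    using assms(1) by (simp add: compact_space_def)
  then obtain \<delta> where \<delta>: "0 < \<delta>" "\<And>p. p \<in> M \<Longrightarrow> \<exists>U\<in>\<C>. mball p \<delta> \<subseteq> U"
    using lebesgue_number[OF _ cover] unfolding \<C>_def by auto
  show thesis
  proof (rule that[OF \<delta>(1)])
    fix p q assume pq: "p \<in> M" "q \<in> M" "d p q < \<delta>"
    obtain U where U: "U \<in> \<C>" "mball p \<delta> \<subseteq> U" using \<delta>(2) pq by blast
    then obtain c where c: "c \<in> M" "U \<subseteq> mball c (\<epsilon>/2)" and Up: "path_connectedin mtopology U"
      unfolding \<C>_def by blast
    have inU: "p \<in> U" "q \<in> U" using U pq \<delta> by (auto simp: subset_iff)
    then obtain \<gamma> where g: "pathin mtopology \<gamma>" "\<gamma> ` {0..1} \<subseteq> U" "\<gamma> 0 = p" "\<gamma> 1 = q"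
      using Up unfolding path_connectedin by (metis image_subset_iff_funcset)
    have "d p (\<gamma> t) \<le> \<epsilon>" if "t \<in> {0..1}" for t
    proof -
      have "\<gamma> t \<in> U" using g(2) that by blast
      then have "\<gamma> t \<in> mball c (\<epsilon>/2)" "p \<in> mball c (\<epsilon>/2)"
        using c inU by blast+
      then show ?thesis
        using triangle[of p c "\<gamma> t"] commute[of p c] by (auto simp: in_mball)
    qed
    with g show "\<exists>\<gamma>. pathin mtopology \<gamma> \<and> \<gamma> 0 = p \<and> \<gamma> 1 = q \<and> (\<forall>t\<in>{0..1}. d p (\<gamma> t) \<le> \<epsilon>)"
      by blast
  qed
qed

text \<open>Index \<open>j\<close> is attached to the deepest admissible predecessor; maximality is what
  later forces every level to be finite.\<close>

lemma greedy_levels: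
  fixes D :: "nat \<Rightarrow> nat \<Rightarrow> nat \<Rightarrow> bool"
  assumes "\<And>j. 0 < j \<Longrightarrow> D 0 j 0"
  obtains lev par :: "nat \<Rightarrow> nat" where
    "\<And>j. 0 < j \<Longrightarrow> par j < j \<and> lev j = Suc (lev (par j)) \<and> D (par j) j (lev (par j))"
    "\<And>i j. \<lbrakk>i < j; D i j (lev i)\<rbrakk> \<Longrightarrow> lev i < lev j"
proof -
  \<comment> \<open>\<open>P f j r\<close> reads \<open>f\<close> only below \<open>j\<close>, so it
    can drive a well-founded recursion; it makes \<open>lev j\<close> one more than the largest
    level of an admissible predecessor.\<close>
  define P where "P = (\<lambda>(f::nat\<Rightarrow>nat) j r. if j = 0 then r = 0 else
     (\<exists>p<j. r = Suc (f p) \<and> D p j (f p)) \<and> (\<forall>i<j. D i j (f i) \<longrightarrow> f i < r))"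
  have "\<exists>f. \<forall>j. P f j (f j)"
  proof (rule dependent_wf_choice[of less_than])
    fix f g :: "nat \<Rightarrow> nat" and j r
    assume "\<And>z. (z, j) \<in> less_than \<Longrightarrow> f z = g z"
    then have "f z = g z" if "z < j" for z using that by simp
    then show "P f j r = P g j r" unfolding P_def by auto
  next
    fix j and f :: "nat \<Rightarrow> nat"
    assume IH: "\<And>y. (y, j) \<in> less_than \<Longrightarrow> P f y (f y)"
    show "\<exists>r. P f j r"
    proof (cases "j = 0")
      case True then show ?thesis by (simp add: P_def)
    next
      case False
      let ?S = "{i. i < j \<and> D i j (f i)}"
      have "f 0 = 0" using IH[of 0] False by (simp add: P_def)
      then have "0 \<in> ?S" using assms False by auto
      then have ne: "finite (f ` ?S)" "f ` ?S \<noteq> {}" by auto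
      obtain p where p: "p \<in> ?S" "f p = Max (f ` ?S)"
        using Max_in[OF ne] by (metis (no_types, lifting) imageE)
      have "f i < Suc (f p)" if "i < j" "D i j (f i)" for i
        using p that ne(1) by (simp add: less_Suc_eq_le)
      then have "P f j (Suc (f p))"
        using p False unfolding P_def by auto
      then show ?thesis ..
    qed
  qed simp
  then obtain lev where lev: "\<And>j. P lev j (lev j)" by blast
  have "\<exists>p<j. lev j = Suc (lev p) \<and> D p j (lev p)" if "0 < j" for j
    using lev[of j] that unfolding P_def by auto
  then obtain par where "\<And>j. 0 < j \<Longrightarrow> par j < j \<and> lev j = Suc (lev (par j)) \<and> D (par j) j (lev (par j))"
    by metis
  moreover have "lev i < lev j" if "i < j" "D i j (lev i)" for i j
    using lev[of j] that unfolding P_def by auto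
  ultimately show thesis using that by blast
qed

text \<open>An interval is a pair (left end, width). Inserting index \<open>Suc N\<close> uses the right half of
  the interval still free at its parent: one eighth to travel out, one eighth
  that is never touched again, one eighth left free for descendants, one eighth to travel back.\<close>

primrec free_interval :: "(nat \<Rightarrow> nat) \<Rightarrow> nat \<Rightarrow> nat \<Rightarrow> real \<times> real" where
  "free_interval par 0 = (\<lambda>i. (0, 1))"
| "free_interval par (Suc N) = (let (c, w) = free_interval par N (par (Suc N)) in
     (free_interval par N)(par (Suc N) := (c, w/2), Suc N := (c + 3*w/4, w/8)))"

text \<open>A tent function over the right half of the interval: 0 at the midpoint, 1 at five
  eighths, 2 at three quarters, 1 at seven eighths, 0 at the right end, and negative elsewhere.
  Capped at 1 it is the parameter of an out-and-back trip.\<close>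

definition excursion_time :: "real \<times> real \<Rightarrow> real \<Rightarrow> real" where
  "excursion_time I t = min (8 * (t - fst I) / snd I - 4) (8 - 8 * (t - fst I) / snd I)"

primrec walk :: "(nat \<Rightarrow> nat) \<Rightarrow> (nat \<Rightarrow> real \<Rightarrow> 'a) \<Rightarrow> 'a \<Rightarrow> nat \<Rightarrow> real \<Rightarrow> 'a" where
  "walk par \<gamma> z 0 = (\<lambda>t. z)"
| "walk par \<gamma> z (Suc N) = (\<lambda>t.
     let m = excursion_time (free_interval par N (par (Suc N))) t
     in if 0 \<le> m then \<gamma> (Suc N) (min 1 m) else walk par \<gamma> z N t)"

lemma excursion_time_ge_iff:
  assumes "0 < w"
  shows "u \<le> excursion_time (c, w) t \<longleftrightarrow> c + w/2 + u * w/8 \<le> t \<and> t \<le> c + w - u * w/8"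
  using assms by (auto simp: excursion_time_def field_simps)

lemma continuous_on_excursion_time: "continuous_on S (excursion_time I)"
proof -
  have "excursion_time I = (\<lambda>t. min (8 * (t - fst I) * inverse (snd I) - 4) (8 - 8 * (t - fst I) * inverse (snd I)))"
    by (simp add: excursion_time_def divide_inverse fun_eq_iff)
  then show ?thesis by (simp only:) (intro continuous_intros)
qed

section \<open>Nested excursions, their resting segments and the limit path\<close>

locale excursion_tree = Metric_space M d for M :: "'a set" and d +
  fixes x :: "nat \<Rightarrow> 'a" and par lev :: "nat \<Rightarrow> nat" and \<gamma> :: "nat \<Rightarrow> real \<Rightarrow> 'a" and B :: real
  assumes par_le: "par (Suc N) \<le> N"
    and lev_Suc: "lev (Suc N) = Suc (lev (par (Suc N)))"
    and xM: "x i \<in> M"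
    and path: "pathin mtopology (\<gamma> (Suc N))"
    and path_start: "\<gamma> (Suc N) 0 = x (par (Suc N))"
    and path_finish: "\<gamma> (Suc N) 1 = x (Suc N)"
    and path_close: "t \<in> {0..1} \<Longrightarrow> d (x (par (Suc N))) (\<gamma> (Suc N) t) \<le> B / 2 ^ lev (par (Suc N))"
    and lev_finite: "finite {i. lev i \<le> m}"
    and B_pos: "0 < B"
begin

abbreviation "lo N i \<equiv> fst (free_interval par N i)"
abbreviation "wd N i \<equiv> snd (free_interval par N i)"
abbreviation "W \<equiv> walk par \<gamma> (x 0)"
abbreviation "p N \<equiv> par (Suc N)"

lemma free_interval_Suc:
  "lo (Suc N) i = (if i = Suc N then lo N (p N) + 3 * wd N (p N) / 4 else lo N i)"
  "wd (Suc N) i = (if i = Suc N then wd N (p N) / 8 else if i = p N then wd N i / 2 else wd N i)"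
  using par_le[of N] by (auto simp: split_beta Let_def)

declare free_interval.simps(2)[simp del]

lemma wd_pos: "0 < wd N i"
  by (induction N arbitrary: i) (auto simp: free_interval_Suc)

lemma free_interval_bounds: "0 \<le> lo N i \<and> lo N i + wd N i \<le> 1"
proof (induction N arbitrary: i)
  case 0 then show ?case by simp
next
  case (Suc N)
  show ?case using Suc[of "p N"] Suc[of i] wd_pos[of N "p N"] wd_pos[of N i]
    by (simp add: free_interval_Suc; linarith)
qed

text \<open>Only the interval of \<open>p N\<close> is cut: it keeps its left half, the new one
  begins at three quarters of it, and both remain inside the old interval, which was separated from
  all others.\<close>

lemma free_interval_separated:
  "\<lbrakk>i \<le> N; k \<le> N; i \<noteq> k\<rbrakk> \<Longrightarrow> lo N i + wd N i \<le> lo N k \<or> lo N k + wd N k \<le> lo N i"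
proof (induction N arbitrary: i k)
  case 0 then show ?case by simp
next
  case (Suc N)
  have pos: "0 < wd N (p N)" "0 < wd N i" "0 < wd N k" by (rule wd_pos)+
  have *: "lo (Suc N) j = lo N j \<and> lo (Suc N) j + wd (Suc N) j \<le> lo N j + wd N j"
    if "j \<le> N" for j using that wd_pos[of N j] by (auto simp: free_interval_Suc)
  have new: "lo (Suc N) j + wd (Suc N) j \<le> lo (Suc N) (Suc N) \<or> lo (Suc N) (Suc N) + wd (Suc N) (Suc N) \<le> lo (Suc N) j"
    if "j \<le> N" for j
  proof (cases "j = p N")
    case True then show ?thesis using pos that by (simp add: free_interval_Suc)
  next
    case False
    then show ?thesis using Suc.IH[OF that par_le[of N] False] pos(1) that
      by (auto simp: free_interval_Suc)
  qed
  consider "i = Suc N" "k \<le> N" | "k = Suc N" "i \<le> N" | "i \<le> N" "k \<le> N" using Suc.prems by linarith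
  then show ?case
  proof cases
    case 3
    then show ?thesis using Suc.IH[OF 3 Suc.prems(3)] *[OF 3(1)] *[OF 3(2)] by linarith
  qed (use new in blast)+
qed

text \<open>The segment from 5/8 to 6/8 of the parent's interval: the excursion of
  \<open>Suc N\<close> has reached its far end, and the free interval of \<open>Suc N\<close> begins
  only at 6/8. The index is shifted: \<open>rest_lo N\<close> belongs to the point
  \<open>x (Suc N)\<close>.\<close>

definition rest_lo where "rest_lo N = lo N (p N) + 5 * wd N (p N) / 8"
definition rest_hi where "rest_hi N = lo N (p N) + 6 * wd N (p N) / 8"

lemma rest_bounds: "0 < rest_lo N \<and> rest_lo N < rest_hi N \<and> rest_hi N < 1"
  using wd_pos[of N "p N"] free_interval_bounds[of N "p N"] by (auto simp: rest_lo_def rest_hi_def)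

text \<open>At the insertion of \<open>Suc j\<close> the segment falls between the half kept by the
  parent and the new free interval. Later steps only shrink or subdivide free intervals, so none of
  them ever enters it.\<close>

lemma rest_separated_free:
  "\<lbrakk>j < N; i \<le> N\<rbrakk> \<Longrightarrow> lo N i + wd N i \<le> rest_lo j \<or> rest_hi j \<le> lo N i"
proof (induction N arbitrary: i)
  case 0 then show ?case by simp
next
  case (Suc N)
  have pos: "0 < wd N (p N)" "0 < wd N i" by (rule wd_pos)+
  show ?case
  proof (cases "j = N")
    case True
    show ?thesis
    proof (cases "i = Suc N \<or> i = p N")
      case True
      then show ?thesis using pos \<open>j = N\<close> par_le[of N]
        by (auto simp: free_interval_Suc rest_lo_def rest_hi_def)
    next
      case False
      then show ?thesis using pos \<open>j = N\<close> free_interval_separated[of i N "p N"] par_le[of N] Suc.prems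
        by (auto simp: free_interval_Suc rest_lo_def rest_hi_def)
    qed
  next
    case False
    then have "j < N" using Suc.prems by simp
    show ?thesis
      using Suc.IH[OF \<open>j < N\<close>, of i] Suc.IH[OF \<open>j < N\<close> par_le] Suc.prems pos
      by (auto simp: free_interval_Suc)
  qed
qed

lemma rest_separated: "i < j \<Longrightarrow> rest_hi i \<le> rest_lo j \<or> rest_hi j \<le> rest_lo i"
  using rest_separated_free[of i j "p j"] par_le[of j] wd_pos[of j "p j"]
  by (auto simp: rest_lo_def rest_hi_def)

lemma W_Suc:
  "W (Suc N) t = (if lo N (p N) + wd N (p N) / 2 \<le> t \<and> t \<le> lo N (p N) + wd N (p N)
     then \<gamma> (Suc N) (min 1 (excursion_time (free_interval par N (p N)) t)) else W N t)"
  using excursion_time_ge_iff[of "wd N (p N)" 0 "lo N (p N)" t] wd_pos[of N "p N"]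
  by (simp add: Let_def)

declare walk.simps(2)[simp del]

text \<open>This invariant lets an excursion be inserted in the parent's free interval without
  breaking continuity. The free interval of a new index lies where its excursion waits at the far
  end; the other free intervals meet the excursion at most in an endpoint.\<close>

lemma W_free: "\<lbrakk>i \<le> N; lo N i \<le> t; t \<le> lo N i + wd N i\<rbrakk> \<Longrightarrow> W N t = x i"
proof (induction N arbitrary: i)
  case 0 then show ?case by simp
next
  case (Suc N)
  let ?m = "excursion_time (free_interval par N (p N)) t"
  have pos: "0 < wd N (p N)" "0 < wd N i" by (rule wd_pos)+
  have m: "u \<le> ?m \<longleftrightarrow> lo N (p N) + wd N (p N)/2 + u * wd N (p N)/8 \<le> t \<and> t \<le> lo N (p N) + wd N (p N) - u * wd N (p N)/8" for u
    using excursion_time_ge_iff[OF pos(1), of u "lo N (p N)" t] by simp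
  have W: "W (Suc N) t = (if 0 \<le> ?m then \<gamma> (Suc N) (min 1 ?m) else W N t)" by (simp add: Let_def walk.simps(2))
  show ?case
  proof (cases "i = Suc N")
    case True
    then have "1 \<le> ?m" using Suc.prems pos by (simp add: m free_interval_Suc)
    then show ?thesis using W path_finish True by simp
  next
    case False
    then have i: "i \<le> N" "lo N i \<le> t" "t \<le> lo N i + wd N i"
      using Suc.prems pos by (auto simp: free_interval_Suc split: if_splits)
    then have Wi: "W N t = x i" by (rule Suc.IH)
    \<comment> \<open>A positive excursion time puts \<open>t\<close> strictly inside the right half
      of the parent's old interval: the parent kept only the left half, and any other interval is
      separated from it.\<close>
    have "?m \<le> 0"
    proof (rule ccontr)
      assume "\<not> ?m \<le> 0"
      then have "0 < ?m" by simp
      then have *: "lo N (p N) + wd N (p N)/2 < t" "t < lo N (p N) + wd N (p N)"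
        using m[of ?m] pos(1) by (smt (verit) mult_pos_pos divide_pos_pos)+
      show False
      proof (cases "i = p N")
        case True then show False using Suc.prems False * by (simp add: free_interval_Suc)
      next
        case ip: False
        then show False using free_interval_separated[OF i(1) par_le ip] * i pos by linarith
      qed
    qed
    moreover have "W (Suc N) t = x i" if m0: "?m = 0"
    proof -
      have "W N t = x (p N)" using m[of 0] m0 pos(1) Suc.IH[OF par_le] by simp
      then show ?thesis using W Wi m0 path_start[of N] by simp
    qed
    ultimately show ?thesis using W Wi by (cases "?m = 0") auto
  qed
qed

text \<open>The two branches meet where the excursion time is 0; such times lie in the free interval
  of the parent, where the earlier walk stands at the starting point of
  \<open>\<gamma> (Suc N)\<close>.\<close>

lemma continuous_W: "continuous_map (top_of_set {0..1}) mtopology (W N)"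
proof (induction N)
  case 0 then show ?case using xM by simp
next
  case (Suc N)
  let ?m = "excursion_time (free_interval par N (p N))"
  let ?I = "top_of_set {0..1::real}"
  have m: "0 \<le> ?m t \<longleftrightarrow> lo N (p N) + wd N (p N)/2 \<le> t \<and> t \<le> lo N (p N) + wd N (p N)" for t
    using excursion_time_ge_iff[OF wd_pos[of N "p N"], of 0 "lo N (p N)" t] by simp
  have "continuous_map ?I mtopology (\<lambda>t. if 0 \<le> ?m t then \<gamma> (Suc N) (min 1 (?m t)) else W N t)"
  proof (rule continuous_map_cases_le)
    show "continuous_map ?I euclideanreal ?m"
      by (simp add: continuous_on_excursion_time)
    show "continuous_map (subtopology ?I {t \<in> topspace ?I. 0 \<le> ?m t}) mtopology (\<lambda>t. \<gamma> (Suc N) (min 1 (?m t)))"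
    proof (rule continuous_map_compose[where g = "\<gamma> (Suc N)" and X' = ?I, unfolded o_def])
      show "continuous_map (subtopology ?I {t \<in> topspace ?I. 0 \<le> ?m t}) ?I (\<lambda>t. min 1 (?m t))"
        by (auto simp: continuous_map_in_subtopology subtopology_subtopology
                  intro!: continuous_intros continuous_on_excursion_time)
      show "continuous_map ?I mtopology (\<gamma> (Suc N))" using path[of N] by (simp add: pathin_def)
    qed
    show "\<gamma> (Suc N) (min 1 (?m t)) = W N t" if "0 = ?m t" for t
      using that m[of t] W_free[OF par_le, of N t] wd_pos[of N "p N"] path_start[of N]
      by simp
  qed (use Suc in \<open>auto intro: continuous_map_from_subtopology\<close>)
  then show ?case by (simp add: Let_def walk.simps(2))
qed

lemma W_in: "t \<in> {0..1} \<Longrightarrow> W N t \<in> M"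
  using continuous_W[of N] by (auto simp: continuous_map_def Pi_iff)

lemma W_0: "W N 0 = x 0"
proof -
  have "lo N 0 = 0" by (induction N) (auto simp: free_interval_Suc)
  then show ?thesis using W_free[of 0 N 0] wd_pos[of N 0] by simp
qed

lemma W_rest:
  assumes "j < N" "rest_lo j < t" "t < rest_hi j"
  shows "W N t = x (Suc j)"
  using assms(1)
proof (induction N)
  case 0 then show ?case by simp
next
  case (Suc N)
  have pos: "0 < wd N (p N)" by (rule wd_pos)
  show ?case
  proof (cases "j = N")
    case True
    have "1 \<le> excursion_time (free_interval par N (p N)) t"
      using excursion_time_ge_iff[OF pos, of 1 "lo N (p N)" t] assms pos True
      by (simp add: rest_lo_def rest_hi_def)
    then show ?thesis using path_finish[of N] True by (simp add: Let_def walk.simps(2))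
  next
    case False
    then have "j < N" using Suc.prems by simp
    then show ?thesis
      using rest_separated_free[OF \<open>j < N\<close> par_le] assms(2,3) Suc.IH pos
      by (auto simp: W_Suc)
  qed
qed

text \<open>Levels strictly increase along nested excursions, so the deviations form a geometric
  series even though many excursions may have comparable size.\<close>

lemma W_uniformly_close:
  assumes deep: "\<And>i. N0 < i \<Longrightarrow> m < lev i" and t: "t \<in> {0..1}" and "N0 \<le> N"
  shows "d (W N t) (W N0 t) \<le> 4 * B / 2 ^ m \<and>
    (\<forall>i\<le>N. lo N i \<le> t \<and> t \<le> lo N i + wd N i \<longrightarrow>
       d (x i) (W N0 t) \<le> (if i \<le> N0 then 0 else 4 * B / 2 ^ m - 4 * B / 2 ^ lev i))"
  using \<open>N0 \<le> N\<close>
proof (induction N rule: dec_induct)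
  case base
  have "d (W N0 t) (W N0 t) = 0" using W_in[OF t] by simp
  then show ?case using W_free[of _ N0 t] B_pos W_in[OF t] xM by auto
next
  case (step N)
  \<comment> \<open>The distance allowed at \<open>Suc N\<close>: of the total
    \<open>4 * B / 2 ^ m\<close>, the amount \<open>4 * B / 2 ^ lev (Suc N)\<close> is held back for
    the descendants.\<close>
  let ?e = "4 * B / 2 ^ m - 4 * B / 2 ^ lev (Suc N)"
  have pos: "0 < wd N (p N)" by (rule wd_pos)
  have lev: "m < lev (Suc N)" using deep step by simp
  have pw: "4 * B / 2 ^ lev (Suc N) \<le> 2 * B / 2 ^ m" "0 < B / 2 ^ lev (Suc N)"
  proof -
    have "(2::real) ^ Suc m \<le> 2 ^ lev (Suc N)" using lev by (intro power_increasing) auto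
    then show "4 * B / 2 ^ lev (Suc N) \<le> 2 * B / 2 ^ m" using B_pos
      by (simp add: field_simps)
  qed (use B_pos in simp)
  \<comment> \<open>With \<open>q = B / 2 ^ lev (Suc N)\<close> the excursion costs
    \<open>2 * q\<close>. A parent beyond \<open>N0\<close> has held back \<open>8 * q\<close>, so
    \<open>6 * q\<close> remain and \<open>4 * q\<close> are needed; for a parent up to
    \<open>N0\<close> the distance is 0, and \<open>6 * q\<close> is below the total.\<close>
  have parent: "d (x (p N)) (W N0 t) + B / 2 ^ lev (p N) \<le> ?e"
    if "lo N (p N) \<le> t" "t \<le> lo N (p N) + wd N (p N)"
  proof -
    have *: "d (x (p N)) (W N0 t) \<le> (if p N \<le> N0 then 0 else 4 * B / 2 ^ m - 4 * B / 2 ^ lev (p N))"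
      using step.IH that par_le by blast
    have "B / 2 ^ lev (p N) = 2 * (B / 2 ^ lev (Suc N))" "4 * B / 2 ^ lev (p N) = 8 * (B / 2 ^ lev (Suc N))"
      by (simp_all add: lev_Suc)
    then show ?thesis using * pw by (auto split: if_splits)
  qed
  have e: "?e \<le> 4 * B / 2 ^ m" using pw by simp
  have 1: "d (W (Suc N) t) (W N0 t) \<le> 4 * B / 2 ^ m"
  proof (cases "lo N (p N) + wd N (p N) / 2 \<le> t \<and> t \<le> lo N (p N) + wd N (p N)")
    case True
    let ?u = "min 1 (excursion_time (free_interval par N (p N)) t)"
    have "0 \<le> excursion_time (free_interval par N (p N)) t"
      using excursion_time_ge_iff[OF pos, of 0 "lo N (p N)" t] True by simp
    then have "d (x (p N)) (\<gamma> (Suc N) ?u) \<le> B / 2 ^ lev (p N)"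
      by (intro path_close) auto
    moreover have "W (Suc N) t = \<gamma> (Suc N) ?u" using True W_Suc by simp
    ultimately have "d (x (p N)) (W (Suc N) t) \<le> B / 2 ^ lev (p N)" by simp
    moreover have "d (W (Suc N) t) (W N0 t) \<le> d (x (p N)) (W (Suc N) t) + d (x (p N)) (W N0 t)"
      using triangle[of "W (Suc N) t" "x (p N)" "W N0 t"] W_in[OF t] xM commute by metis
    ultimately show ?thesis using parent True pos e by simp
  next
    case False
    then show ?thesis using step.IH by (subst W_Suc) auto
  qed
  have 2: "d (x i) (W N0 t) \<le> (if i \<le> N0 then 0 else 4 * B / 2 ^ m - 4 * B / 2 ^ lev i)"
    if i: "i \<le> Suc N" "lo (Suc N) i \<le> t" "t \<le> lo (Suc N) i + wd (Suc N) i" for i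
  proof (cases "i = Suc N")
    case True
    then have W: "W (Suc N) t = x (Suc N)" using W_free i by blast
    have "lo N (p N) + wd N (p N) / 2 \<le> t" "t \<le> lo N (p N) + wd N (p N)"
      using i pos True by (auto simp: free_interval_Suc)
    then have "d (x (p N)) (W N0 t) + B / 2 ^ lev (p N) \<le> ?e" using parent pos by simp
    moreover have "d (x (p N)) (x (Suc N)) \<le> B / 2 ^ lev (p N)"
      using path_close[of 1 N] path_finish[of N] by simp
    moreover have "d (x (Suc N)) (W N0 t) \<le> d (x (p N)) (x (Suc N)) + d (x (p N)) (W N0 t)"
      using triangle[of "x (Suc N)" "x (p N)" "W N0 t"] W_in[OF t] xM commute by metis
    ultimately show ?thesis using True step.hyps by simp
  next
    case False
    then have "i \<le> N" "lo N i \<le> t" "t \<le> lo N i + wd N i"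
      using i wd_pos[of N i] by (auto simp: free_interval_Suc split: if_splits)
    then show ?thesis using step.IH by blast
  qed
  show ?case using 1 2 by blast
qed

text \<open>Only finitely many indices lie at or below a given level, so all excursions beyond some
  stage are deep and together move the walk little: the walks are uniformly Cauchy. At a resting
  time, and at time 0, they are eventually constant, which fixes the limit there.\<close>

lemma limit_path:
  assumes "mcomplete"
  obtains \<beta> where "continuous_map (top_of_set {0..1}) mtopology \<beta>" "\<beta> 0 = x 0"
    "\<And>j t. \<lbrakk>rest_lo j < t; t < rest_hi j\<rbrakk> \<Longrightarrow> \<beta> t = x (Suc j)"
proof -
  have cauchy: "\<exists>N. \<forall>k l t. N \<le> k \<longrightarrow> N \<le> l \<longrightarrow> t \<in> topspace (top_of_set {0..1}) \<longrightarrow> d (W k t) (W l t) < \<epsilon>"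
    if "0 < \<epsilon>" for \<epsilon>
  proof -
    obtain m where "8 * B / \<epsilon> < 2 ^ m" using real_arch_pow[of 2 "8 * B / \<epsilon>"] by auto
    then have m: "8 * B / 2 ^ m < \<epsilon>" using that by (simp add: field_simps)
    obtain N0 where N0: "\<And>i. lev i \<le> m \<Longrightarrow> i \<le> N0"
      using lev_finite[of m] finite_nat_set_iff_bounded_le by auto
    then have deep: "m < lev i" if "N0 < i" for i using that by (meson not_le)
    have "d (W k t) (W l t) < \<epsilon>" if "N0 \<le> k" "N0 \<le> l" "t \<in> {0..1}" for k l t
    proof -
      have "d (W k t) (W l t) \<le> d (W k t) (W N0 t) + d (W l t) (W N0 t)"
        using triangle[of "W k t" "W N0 t" "W l t"] W_in[OF that(3)] commute by metis
      also have "\<dots> \<le> 4 * B / 2 ^ m + 4 * B / 2 ^ m"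
        using W_uniformly_close[OF deep that(3)] that by (intro add_mono) auto
      finally show ?thesis using m by simp
    qed
    then show ?thesis by auto
  qed
  obtain \<beta> where \<beta>: "continuous_map (top_of_set {0..1}) mtopology \<beta>"
    "\<And>\<epsilon>. 0 < \<epsilon> \<Longrightarrow> \<forall>\<^sub>F n in sequentially. \<forall>t\<in>topspace (top_of_set {0..1}). d (W n t) (\<beta> t) < \<epsilon>"
    by (rule continuous_map_uniformly_Cauchy_limit[OF assms, of "top_of_set {0..1}" W])
      (use continuous_W cauchy in \<open>auto simp del: topspace_euclidean_subtopology\<close>)
  have eq: "\<beta> t = z" if "t \<in> {0..1}" and "\<forall>\<^sub>F n in sequentially. W n t = z" for t z
  proof (rule ccontr)
    assume ne: "\<beta> t \<noteq> z"
    have "\<beta> t \<in> M" using \<beta>(1) that(1) by (auto simp: continuous_map_def Pi_iff)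
    moreover have "z \<in> M" using that W_in[OF that(1)] eventually_happens[OF that(2)] by auto
    ultimately have "0 < d z (\<beta> t)" using ne by auto
    then have "\<forall>\<^sub>F n in sequentially. d (W n t) (\<beta> t) < d z (\<beta> t)"
      using \<beta>(2) that(1) by (fastforce elim: eventually_mono)
    with that(2) have "\<forall>\<^sub>F n in sequentially. False"
      by eventually_elim simp
    then show False by simp
  qed
  show thesis
  proof (rule that[OF \<beta>(1)])
    show "\<beta> 0 = x 0" using eq[of 0 "x 0"] W_0 by simp
    fix j t assume jt: "rest_lo j < t" "t < rest_hi j"
    have "\<forall>\<^sub>F n in sequentially. W n t = x (Suc j)"
      using eventually_gt_at_top[of j] by eventually_elim (use W_rest jt in blast)
    then show "\<beta> t = x (Suc j)" using eq[of t] jt rest_bounds[of j] by simp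
  qed
qed

end

text \<open>The tree of excursions is grown on the sequence with \<open>y0\<close> put in front.
  Total boundedness keeps each level finite, and completeness supplies the limit of the
  walks.\<close>

proposition path_resting_at_sequence:
  assumes X: "metrizable_space X" "compact_space X" "connected_space X" "locally_path_connected_space X"
    and "y0 \<in> topspace X" "\<And>j. x j \<in> topspace X"
  obtains \<beta> and l r :: "nat \<Rightarrow> real" where
    "continuous_map (top_of_set {0..1}) X \<beta>" "\<beta> 0 = y0"
    "\<And>j. 0 \<le> l j \<and> l j < r j \<and> r j \<le> 1"
    "\<And>j t. \<lbrakk>l j < t; t < r j\<rbrakk> \<Longrightarrow> \<beta> t = x j"
    "\<And>i j. i \<noteq> j \<Longrightarrow> r i \<le> l j \<or> r j \<le> l i"
proof -
  obtain M d where "Metric_space M d" and Xeq: "X = Metric_space.mtopology M d"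
    using X(1) unfolding metrizable_space_def by blast
  interpret Metric_space M d by fact
  have tb: "mtotally_bounded M" and mc: "mcomplete"
    using X(2) Xeq compact_space_eq_mcomplete_mtotally_bounded by auto
  \<comment> \<open>\<open>y0\<close> becomes the root, index 0, so \<open>x j\<close> is
    \<open>z (Suc j)\<close>, matching the shift in \<open>rest_lo\<close> and
    \<open>rest_hi\<close>.\<close>
  define z where "z = (\<lambda>j. case j of 0 \<Rightarrow> y0 | Suc i \<Rightarrow> x i)"
  have zM: "z j \<in> M" for j using assms(5,6) Xeq by (auto simp: z_def split: nat.split)
  have "mbounded M" using tb by (rule mtotally_bounded_imp_mbounded)
  then obtain C where C: "\<And>p q. \<lbrakk>p \<in> M; q \<in> M\<rbrakk> \<Longrightarrow> d p q \<le> C" unfolding mbounded_alt by blast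
  define B where "B = \<bar>C\<bar> + 1"
  have B: "0 < B" "\<And>p q. \<lbrakk>p \<in> M; q \<in> M\<rbrakk> \<Longrightarrow> d p q < B"
  proof -
    show "d p q < B" if "p \<in> M" "q \<in> M" for p q using C[OF that] by (simp add: B_def)
  qed (simp add: B_def)
  have pc: "path_connected_space X"
    using X(3,4) path_connected_eq_connected_space by blast
  \<comment> \<open>At level 0 the radius is \<open>B\<close> itself: every index is then admissible
    under the root, as \<open>greedy_levels\<close> requires, and any path at all satisfies the
    bound.\<close>
  have "\<exists>\<delta>>0. (m = 0 \<longrightarrow> \<delta> = B) \<and> (\<forall>p\<in>M. \<forall>q\<in>M. d p q < \<delta> \<longrightarrow>
       (\<exists>\<gamma>. pathin mtopology \<gamma> \<and> \<gamma> 0 = p \<and> \<gamma> 1 = q \<and> (\<forall>t\<in>{0..1}. d p (\<gamma> t) \<le> B / 2 ^ m)))" for m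
  proof (cases "m = 0")
    case True
    have "\<exists>\<gamma>. pathin mtopology \<gamma> \<and> \<gamma> 0 = p \<and> \<gamma> 1 = q \<and> (\<forall>t\<in>{0..1}. d p (\<gamma> t) \<le> B / 2 ^ m)"
      if "p \<in> M" "q \<in> M" for p q
    proof -
      have "p \<in> topspace X" "q \<in> topspace X" using that Xeq by simp_all
      then obtain \<gamma> where "pathin X \<gamma>" "\<gamma> 0 = p" "\<gamma> 1 = q"
        using pc unfolding path_connected_space_def by metis
      then have g: "pathin mtopology \<gamma>" "\<gamma> 0 = p" "\<gamma> 1 = q" using Xeq by simp_all
      have "\<gamma> t \<in> M" if "t \<in> {0..1}" for t
        using that g(1) by (auto simp: pathin_def continuous_map_def Pi_iff)
      then have "d p (\<gamma> t) \<le> B / 2 ^ m" if "t \<in> {0..1}" for t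
        using B(2)[OF \<open>p \<in> M\<close>, of "\<gamma> t"] that True by simp
      then show ?thesis using g by blast
    qed
    then show ?thesis using B(1) by (intro exI[of _ B]) simp
  next
    case False
    have "compact_space mtopology" "locally_path_connected_space mtopology" "0 < B / 2 ^ m"
      using X(2,4) Xeq B(1) by auto
    then obtain \<delta> where "0 < \<delta>" "\<And>p q. \<lbrakk>p \<in> M; q \<in> M; d p q < \<delta>\<rbrakk> \<Longrightarrow>
       \<exists>\<gamma>. pathin mtopology \<gamma> \<and> \<gamma> 0 = p \<and> \<gamma> 1 = q \<and> (\<forall>t\<in>{0..1}. d p (\<gamma> t) \<le> B / 2 ^ m)"
      using uniformly_locally_path_connected[of "B / 2 ^ m"] by metis
    then show ?thesis using False by (intro exI[of _ \<delta>]) simp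
  qed
  then obtain \<delta> where \<delta>: "\<And>m. 0 < \<delta> m" "\<delta> 0 = B"
    and paths: "\<And>m p q. \<lbrakk>p \<in> M; q \<in> M; d p q < \<delta> m\<rbrakk> \<Longrightarrow>
       \<exists>\<gamma>. pathin mtopology \<gamma> \<and> \<gamma> 0 = p \<and> \<gamma> 1 = q \<and> (\<forall>t\<in>{0..1}. d p (\<gamma> t) \<le> B / 2 ^ m)"
    by metis
  obtain lev par where par: "\<And>j. 0 < j \<Longrightarrow> par j < j \<and> lev j = Suc (lev (par j)) \<and> d (z (par j)) (z j) < \<delta> (lev (par j))"
    and greedy: "\<And>i j. \<lbrakk>i < j; d (z i) (z j) < \<delta> (lev i)\<rbrakk> \<Longrightarrow> lev i < lev j"
    by (rule greedy_levels[where D = "\<lambda>i j m. d (z i) (z j) < \<delta> m"]) (use \<delta> B zM in auto)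
  have "\<exists>\<gamma>. pathin mtopology \<gamma> \<and> \<gamma> 0 = z (par j) \<and> \<gamma> 1 = z j \<and>
      (\<forall>t\<in>{0..1}. d (z (par j)) (\<gamma> t) \<le> B / 2 ^ lev (par j))" if "0 < j" for j
    using paths zM par[OF that] by blast
  then obtain \<gamma> where \<gamma>: "\<And>j. 0 < j \<Longrightarrow> pathin mtopology (\<gamma> j) \<and> \<gamma> j 0 = z (par j) \<and> \<gamma> j 1 = z j \<and>
      (\<forall>t\<in>{0..1}. d (z (par j)) (\<gamma> j t) \<le> B / 2 ^ lev (par j))" by metis
  have fin_level: "finite {i. lev i = m}" for m
  proof -
    obtain K where K: "finite K" "M \<subseteq> (\<Union>k\<in>K. mball k (\<delta> m / 2))"
      using tb \<delta>(1)[of m] unfolding mtotally_bounded_def by (metis half_gt_zero)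
    then have "\<exists>k\<in>K. z i \<in> mball k (\<delta> m / 2)" for i using zM by blast
    then obtain k where k: "\<And>i. k i \<in> K" "\<And>i. z i \<in> mball (k i) (\<delta> m / 2)" by metis
    \<comment> \<open>Two indices of level \<open>m\<close> in the same ball would be closer than
      \<open>\<delta> m\<close>, and the maximality in \<open>greedy\<close> would push the later
      one to a deeper level.\<close>
    have "inj_on k {i. lev i = m}"
    proof (rule linorder_inj_onI)
      fix i j assume "i < j" and ij: "i \<in> {i. lev i = m}" "j \<in> {i. lev i = m}"
      show "k i \<noteq> k j"
      proof
        assume "k i = k j"
        then have "d (k i) (z i) < \<delta> m / 2" "d (k i) (z j) < \<delta> m / 2" "k i \<in> M"
          using k(2)[of i] k(2)[of j] by auto
        then have "d (z i) (z j) < \<delta> m"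
          using triangle[of "z i" "k i" "z j"] zM commute[of "z i" "k i"] by simp
        then show False using greedy[OF \<open>i < j\<close>] ij by auto
      qed
    qed auto
    then show ?thesis using K(1) k(1) by (meson finite_imageD finite_subset image_subsetI)
  qed
  have "{i. lev i \<le> m} = (\<Union>k\<le>m. {i. lev i = k})" for m by auto
  then have fin: "finite {i. lev i \<le> m}" for m using fin_level by auto
  have "par (Suc N) \<le> N" for N using par[of "Suc N"] by simp
  then interpret T: excursion_tree M d z par lev \<gamma> B
    by unfold_locales (use par \<gamma> zM B fin in auto)
  obtain \<beta> where "continuous_map (top_of_set {0..1}) mtopology \<beta>" "\<beta> 0 = z 0"
    "\<And>j t. \<lbrakk>T.rest_lo j < t; t < T.rest_hi j\<rbrakk> \<Longrightarrow> \<beta> t = z (Suc j)"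
    using T.limit_path[OF mc] by blast
  moreover have "T.rest_hi i \<le> T.rest_lo j \<or> T.rest_hi j \<le> T.rest_lo i" if "i \<noteq> j" for i j
    using that T.rest_separated[of i j] T.rest_separated[of j i] by linarith
  ultimately show thesis
    using that[of \<beta> T.rest_lo T.rest_hi] T.rest_bounds Xeq
    by (simp add: z_def less_imp_le)
qed

section \<open>Homotopy groups\<close>

abbreviation cube_loop :: "nat \<Rightarrow> 'a topology \<Rightarrow> 'a \<Rightarrow> ((nat \<Rightarrow> real) \<Rightarrow> 'a) \<Rightarrow> bool" where
  "cube_loop n Z z f \<equiv> continuous_map (cube n) Z f \<and> f ` cube_bdry n \<subseteq> {z}"

abbreviation cube_homotopic ::
    "nat \<Rightarrow> 'a topology \<Rightarrow> 'a \<Rightarrow> ((nat \<Rightarrow> real) \<Rightarrow> 'a) \<Rightarrow> ((nat \<Rightarrow> real) \<Rightarrow> 'a) \<Rightarrow> bool" where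
  "cube_homotopic n Z z \<equiv> homotopic_with (\<lambda>h. h ` cube_bdry n \<subseteq> {z}) (cube n) Z"

abbreviation homotopy_cube :: "nat \<Rightarrow> (real \<times> (nat \<Rightarrow> real)) topology" where
  "homotopy_cube n \<equiv> prod_topology (top_of_set {0..1}) (cube n)"

lemma topspace_cube: "topspace (cube n) = ({..<n} \<rightarrow>\<^sub>E {0..1})"
  by (simp add: cube_def)

lemma cube_coord: "\<lbrakk>t \<in> topspace (cube n); i < n\<rbrakk> \<Longrightarrow> 0 \<le> t i \<and> t i \<le> 1"
  by (auto simp: topspace_cube PiE_iff)

lemma cube_ext: "t \<in> topspace (cube n) \<Longrightarrow> t \<in> extensional {..<n}"
  by (simp add: topspace_cube PiE_iff)

lemma cube_memI:
  "\<lbrakk>t \<in> extensional {..<n}; \<And>i. i < n \<Longrightarrow> 0 \<le> t i \<and> t i \<le> 1\<rbrakk> \<Longrightarrow> t \<in> topspace (cube n)"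
  by (auto simp: topspace_cube PiE_iff)

lemma cube_bdry_mem: "t \<in> cube_bdry n \<Longrightarrow> t \<in> topspace (cube n)"
  by (simp add: cube_bdry_def)

lemma cube_bdryI: "\<lbrakk>t \<in> topspace (cube n); i < n; t i = 0 \<or> t i = 1\<rbrakk> \<Longrightarrow> t \<in> cube_bdry n"
  by (auto simp: cube_bdry_def)

lemma cube_upd_mem:
  "\<lbrakk>t \<in> topspace (cube n); i < n; 0 \<le> u; u \<le> 1\<rbrakk> \<Longrightarrow> t(i := u) \<in> topspace (cube n)"
  by (auto simp: topspace_cube PiE_iff extensional_def)

lemma cube_upd_bdry:
  assumes "t \<in> cube_bdry n" "i < n" "0 \<le> u" "u \<le> 1" "t i = 0 \<or> t i = 1 \<Longrightarrow> u = 0 \<or> u = 1"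
  shows "t(i := u) \<in> cube_bdry n"
proof -
  obtain k where "k < n" "t k = 0 \<or> t k = 1" using assms(1) by (auto simp: cube_bdry_def)
  then show ?thesis
    using cube_bdryI[OF cube_upd_mem[OF cube_bdry_mem[OF assms(1)] assms(2-4)], of k]
      cube_bdryI[OF cube_upd_mem[OF cube_bdry_mem[OF assms(1)] assms(2-4)], of i] assms
    by (cases "k = i") auto
qed

text \<open>Points of \<open>cube n\<close> are extensional functions, equal to
  \<open>undefined\<close> from coordinate \<open>n\<close> on; the first premise takes care of
  this.\<close>

lemma continuous_map_into_cube:
  assumes "\<And>p. p \<in> topspace T \<Longrightarrow> F p \<in> extensional {..<n}"
    and "\<And>i. i < n \<Longrightarrow> continuous_map T euclideanreal (\<lambda>p. F p i)"
    and "\<And>p i. \<lbrakk>p \<in> topspace T; i < n\<rbrakk> \<Longrightarrow> 0 \<le> F p i \<and> F p i \<le> 1"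
  shows "continuous_map T (cube n) F"
  using assms by (auto simp: cube_def continuous_map_componentwise continuous_map_in_subtopology)

lemma continuous_map_cube_coord:
  assumes "continuous_map T (cube n) F" "i < n"
  shows "continuous_map T euclideanreal (\<lambda>p. F p i)"
  using assms by (auto simp: cube_def continuous_map_componentwise continuous_map_in_subtopology)

lemma continuous_map_cube_upd:
  assumes F: "continuous_map T (cube n) F" and "i < n" and u: "continuous_map T euclideanreal u"
    and "\<And>p. p \<in> topspace T \<Longrightarrow> 0 \<le> u p \<and> u p \<le> 1"
  shows "continuous_map T (cube n) (\<lambda>p. (F p)(i := u p))"
proof -
  have mem: "F p \<in> topspace (cube n)" if "p \<in> topspace T" for p
    using F that by (auto simp: continuous_map_def Pi_iff)
  show ?thesis
  proof (rule continuous_map_into_cube)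
    show "(F p)(i := u p) \<in> extensional {..<n}" if "p \<in> topspace T" for p
      using cube_ext[OF mem[OF that]] \<open>i < n\<close> by (auto simp: extensional_def)
    show "continuous_map T euclideanreal (\<lambda>p. ((F p)(i := u p)) k)" if "k < n" for k
      using continuous_map_cube_coord[OF F that] u by (cases "k = i") auto
    show "0 \<le> ((F p)(i := u p)) k \<and> ((F p)(i := u p)) k \<le> 1" if "p \<in> topspace T" "k < n" for p k
      using cube_coord[OF mem[OF that(1)] that(2)] assms(4)[OF that(1)] by auto
  qed
qed

lemma continuous_map_homotopy_compose:
  assumes "continuous_map (homotopy_cube n) Z h"
    and "continuous_map T euclideanreal u" "\<And>p. p \<in> topspace T \<Longrightarrow> 0 \<le> u p \<and> u p \<le> 1"
    and "continuous_map T (cube n) F"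
  shows "continuous_map T Z (\<lambda>p. h (u p, F p))"
proof -
  have "continuous_map T (homotopy_cube n) (\<lambda>p. (u p, F p))"
    using assms by (auto intro!: continuous_map_pairedI continuous_map_into_subtopology)
  from continuous_map_compose[OF this assms(1)] show ?thesis by (simp add: o_def)
qed

lemma continuous_map_homotopy_cube:
  shows continuous_map_homotopy_param: "continuous_map (homotopy_cube n) euclideanreal fst"
    and continuous_map_homotopy_point: "continuous_map (homotopy_cube n) (cube n) snd"
  using continuous_map_fst continuous_map_snd continuous_map_into_fulltopology by blast+

text \<open>\<open>homotopic_with\<close> asks for equality with \<open>f\<close> and
  \<open>g\<close> at every argument unless the property is insensitive to values outside the space;
  the boundary condition is, so equality on the cube suffices.\<close>

lemma cube_homotopicI:
  assumes "continuous_map (homotopy_cube n) Z h"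
    and "\<And>t. t \<in> topspace (cube n) \<Longrightarrow> h (0, t) = f t"
    and "\<And>t. t \<in> topspace (cube n) \<Longrightarrow> h (1, t) = g t"
    and "\<And>s t. \<lbrakk>0 \<le> s; s \<le> 1; t \<in> cube_bdry n\<rbrakk> \<Longrightarrow> h (s, t) = z"
  shows "cube_homotopic n Z z f g"
proof -
  have "\<And>h k. (\<And>t. t \<in> topspace (cube n) \<Longrightarrow> h t = k t) \<Longrightarrow> (h ` cube_bdry n \<subseteq> {z}) = (k ` cube_bdry n \<subseteq> {z})"
    using cube_bdry_mem by (metis image_cong)
  from homotopic_with[where P = "\<lambda>h. h ` cube_bdry n \<subseteq> {z}" and X = "cube n", OF this] have "cube_homotopic n Z z f g \<longleftrightarrow> (\<exists>h. continuous_map (homotopy_cube n) Z h \<and>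
      (\<forall>t\<in>topspace (cube n). h (0, t) = f t) \<and> (\<forall>t\<in>topspace (cube n). h (1, t) = g t) \<and>
      (\<forall>s\<in>{0..1}. (\<lambda>t. h (s, t)) ` cube_bdry n \<subseteq> {z}))"
    by simp
  then show ?thesis using assms by (auto intro!: exI[of _ h])
qed

lemma cube_homotopicE:
  assumes "cube_homotopic n Z z f g"
  obtains h where "continuous_map (homotopy_cube n) Z h" "\<And>t. h (0, t) = f t" "\<And>t. h (1, t) = g t"
    "\<And>s t. \<lbrakk>0 \<le> s; s \<le> 1; t \<in> cube_bdry n\<rbrakk> \<Longrightarrow> h (s, t) = z"
  using assms unfolding homotopic_with_def image_subset_iff by (metis atLeastAtMost_iff singletonD)

lemma cube_homotopic_eq:
  assumes "cube_homotopic n Z z f g" "\<And>t. t \<in> topspace (cube n) \<Longrightarrow> f' t = f t"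
  shows "cube_homotopic n Z z f' g"
proof -
  obtain h where "continuous_map (homotopy_cube n) Z h" "\<And>t. h (0, t) = f t" "\<And>t. h (1, t) = g t"
    "\<And>s t. \<lbrakk>0 \<le> s; s \<le> 1; t \<in> cube_bdry n\<rbrakk> \<Longrightarrow> h (s, t) = z"
    using cube_homotopicE[OF assms(1)] by blast
  then show ?thesis using assms(2) by (intro cube_homotopicI[of n Z h]) auto
qed

lemma hclass_eqI: "cube_homotopic n Z z f g \<Longrightarrow> hclass n Z z f = hclass n Z z g"
  unfolding hclass_def by (blast intro: homotopic_with_trans homotopic_with_symD)

lemma hclass_eq_iff:
  assumes "cube_loop n Z z f"
  shows "hclass n Z z f = hclass n Z z g \<longleftrightarrow> cube_homotopic n Z z f g"
proof
  assume eq: "hclass n Z z f = hclass n Z z g"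
  have "f \<in> hclass n Z z f" using assms by (simp add: hclass_def)
  then show "cube_homotopic n Z z f g" using eq by (auto simp: hclass_def homotopic_with_sym)
qed (rule hclass_eqI)

lemma homotopy_group_rep:
  assumes "C \<in> carrier (homotopy_group n Z z)"
  shows "cube_loop n Z z (SOME f. f \<in> C)" "hclass n Z z (SOME f. f \<in> C) = C"
proof -
  obtain f where f: "cube_loop n Z z f" "C = hclass n Z z f"
    using assms by (auto simp: homotopy_group_def)
  then have "f \<in> C" by (simp add: hclass_def)
  then have "(SOME f. f \<in> C) \<in> C" by (rule someI[of "\<lambda>f. f \<in> C"])
  then have *: "cube_homotopic n Z z f (SOME f. f \<in> C)" using f by (simp add: hclass_def)
  show "cube_loop n Z z (SOME f. f \<in> C)"
    using homotopic_with_imp_continuous_maps[OF *] homotopic_with_imp_property[OF *] by simp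
  show "hclass n Z z (SOME f. f \<in> C) = C"
    using hclass_eq_iff[OF f(1)] * f(2) by metis
qed

lemma hclass_in_carrier: "cube_loop n Z z f \<Longrightarrow> hclass n Z z f \<in> carrier (homotopy_group n Z z)"
  by (auto simp: homotopy_group_def)

lemma hclass_rep_homotopic:
  assumes "cube_loop n Z z f"
  shows "cube_homotopic n Z z f (SOME g. g \<in> hclass n Z z f)"
  using hclass_eq_iff[OF assms] homotopy_group_rep(2)[OF hclass_in_carrier[OF assms]] by metis

section \<open>Concatenation and induced homomorphisms\<close>

lemma continuous_map_concat_homotopy:
  assumes h: "continuous_map (homotopy_cube n) Z h" "\<And>s t. \<lbrakk>0 \<le> s; s \<le> 1; t \<in> cube_bdry n\<rbrakk> \<Longrightarrow> h (s, t) = z"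
    and k: "continuous_map (homotopy_cube n) Z k" "\<And>s t. \<lbrakk>0 \<le> s; s \<le> 1; t \<in> cube_bdry n\<rbrakk> \<Longrightarrow> k (s, t) = z"
    and "0 < n"
  shows "continuous_map (homotopy_cube n) Z (\<lambda>(s,t). cube_concat (\<lambda>t. h (s, t)) (\<lambda>t. k (s, t)) t)"
proof -
  let ?T = "homotopy_cube n"
  have c: "continuous_map ?T euclideanreal (\<lambda>p. snd p 0)"
    by (rule continuous_map_cube_coord[OF continuous_map_homotopy_point \<open>0 < n\<close>])
  have half: "0 \<le> snd p 0 \<and> snd p 0 \<le> 1" if "p \<in> topspace ?T" for p
    using cube_coord[of "snd p" n 0] that \<open>0 < n\<close> by auto
  have "continuous_map ?T Z (\<lambda>p. if snd p 0 \<le> 1/2 then h (fst p, (snd p)(0 := 2 * snd p 0))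
      else k (fst p, (snd p)(0 := 2 * snd p 0 - 1)))"
  proof (rule continuous_map_cases_le[OF c])
    show "continuous_map (subtopology ?T {p \<in> topspace ?T. snd p 0 \<le> 1/2}) Z (\<lambda>p. h (fst p, (snd p)(0 := 2 * snd p 0)))"
      by (rule continuous_map_homotopy_compose[OF h(1)] continuous_map_cube_upd continuous_intros
            continuous_map_from_subtopology c \<open>0 < n\<close> continuous_map_homotopy_cube | use half in force)+
    show "continuous_map (subtopology ?T {p \<in> topspace ?T. 1/2 \<le> snd p 0}) Z (\<lambda>p. k (fst p, (snd p)(0 := 2 * snd p 0 - 1)))"
      by (rule continuous_map_homotopy_compose[OF k(1)] continuous_map_cube_upd continuous_intros
            continuous_map_from_subtopology c \<open>0 < n\<close> continuous_map_homotopy_cube | use half in force)+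
    \<comment> \<open>On the wall the rescaled coordinate is 1 from the left and 0 from the right,
      so both sides are evaluated on the boundary.\<close>
    fix p assume p: "p \<in> topspace ?T" "snd p 0 = 1/2"
    then have double: "2 * snd p 0 = 1" by simp
    from p have "(snd p)(0 := 1) \<in> cube_bdry n" "(snd p)(0 := 0) \<in> cube_bdry n"
      using \<open>0 < n\<close> by (auto intro!: cube_bdryI[of _ _ 0] cube_upd_mem)
    then show "h (fst p, (snd p)(0 := 2 * snd p 0)) = k (fst p, (snd p)(0 := 2 * snd p 0 - 1))"
      using p h(2)[of "fst p"] k(2)[of "fst p"] double by (auto simp: mem_Times_iff)
  qed simp
  then show ?thesis by (simp only: cube_concat_def case_prod_unfold)
qed

lemma cube_concat_bdry:
  assumes "\<And>t. t \<in> cube_bdry n \<Longrightarrow> f t = z" "\<And>t. t \<in> cube_bdry n \<Longrightarrow> g t = z" "0 < n" "t \<in> cube_bdry n"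
  shows "cube_concat f g t = z"
proof -
  have t0: "0 \<le> t 0" "t 0 \<le> 1" using cube_coord[OF cube_bdry_mem[OF assms(4)] \<open>0 < n\<close>] by auto
  show ?thesis
  proof (cases "t 0 \<le> 1/2")
    case True
    then have "t(0 := 2 * t 0) \<in> cube_bdry n" using t0 assms(3,4) by (intro cube_upd_bdry) auto
    then show ?thesis using True assms by (simp add: cube_concat_def)
  next
    case False
    then have "t(0 := 2 * t 0 - 1) \<in> cube_bdry n" using t0 assms(3,4) by (intro cube_upd_bdry) auto
    then show ?thesis using False assms by (simp add: cube_concat_def)
  qed
qed

lemma cube_homotopic_concat:
  assumes "cube_homotopic n Z z f f'" "cube_homotopic n Z z g g'" "0 < n"
  shows "cube_homotopic n Z z (cube_concat f g) (cube_concat f' g')"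
proof -
  obtain h where h: "continuous_map (homotopy_cube n) Z h" "\<And>t. h (0, t) = f t" "\<And>t. h (1, t) = f' t"
    "\<And>s t. \<lbrakk>0 \<le> s; s \<le> 1; t \<in> cube_bdry n\<rbrakk> \<Longrightarrow> h (s, t) = z"
    using cube_homotopicE[OF assms(1)] by blast
  obtain k where k: "continuous_map (homotopy_cube n) Z k" "\<And>t. k (0, t) = g t" "\<And>t. k (1, t) = g' t"
    "\<And>s t. \<lbrakk>0 \<le> s; s \<le> 1; t \<in> cube_bdry n\<rbrakk> \<Longrightarrow> k (s, t) = z"
    using cube_homotopicE[OF assms(2)] by blast
  show ?thesis
    by (rule cube_homotopicI[OF continuous_map_concat_homotopy[OF h(1,4) k(1,4) \<open>0 < n\<close>]])
      (auto simp: h k intro!: cube_concat_bdry \<open>0 < n\<close>)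
qed

text \<open>By \<open>homotopic_with_refl\<close> a loop is a map homotopic to itself, so this is
  the diagonal case of \<open>cube_homotopic_concat\<close>.\<close>

lemma cube_loop_concat:
  "\<lbrakk>cube_loop n Z z f; cube_loop n Z z g; 0 < n\<rbrakk> \<Longrightarrow> cube_loop n Z z (cube_concat f g)"
  using cube_homotopic_concat[where f = f and f' = f and g = g and g' = g] by (simp only: homotopic_with_refl)

lemma hclass_mult:
  assumes "cube_loop n Z z f" "cube_loop n Z z g" "0 < n"
  shows "hclass n Z z f \<otimes>\<^bsub>homotopy_group n Z z\<^esub> hclass n Z z g = hclass n Z z (cube_concat f g)"
proof -
  have "hclass n Z z (cube_concat f g) = hclass n Z z (cube_concat (SOME h. h \<in> hclass n Z z f) (SOME h. h \<in> hclass n Z z g))"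
    unfolding hclass_eq_iff[OF cube_loop_concat[OF assms]]
    by (rule cube_homotopic_concat[OF hclass_rep_homotopic[OF assms(1)] hclass_rep_homotopic[OF assms(2)] assms(3)])
  then show ?thesis by (simp add: homotopy_group_def)
qed

lemma cube_homotopic_compose:
  assumes "cube_homotopic n Z z f g" "continuous_map Z W \<phi>" "\<phi> z = w"
  shows "cube_homotopic n W w (\<phi> \<circ> f) (\<phi> \<circ> g)"
  using assms(1,2) by (rule homotopic_with_compose_continuous_map_left) (use assms(3) in auto)

lemma induced_hom_hclass:
  assumes "cube_loop n Z z f" "continuous_map Z W \<phi>" "\<phi> z = w"
  shows "cube_loop n W w (\<phi> \<circ> f)" "induced_hom n W w \<phi> (hclass n Z z f) = hclass n W w (\<phi> \<circ> f)"
proof -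
  have *: "cube_homotopic n W w (\<phi> \<circ> f) (\<phi> \<circ> (SOME g. g \<in> hclass n Z z f))"
    by (rule cube_homotopic_compose[OF hclass_rep_homotopic[OF assms(1)] assms(2,3)])
  show loop: "cube_loop n W w (\<phi> \<circ> f)"
    using homotopic_with_imp_continuous_maps[OF *] homotopic_with_imp_property[OF *] by simp
  show "induced_hom n W w \<phi> (hclass n Z z f) = hclass n W w (\<phi> \<circ> f)"
    unfolding induced_hom_def using hclass_eq_iff[OF loop] * by blast
qed

lemma homotopy_group_carrierE:
  assumes "C \<in> carrier (homotopy_group n Z z)"
  obtains f where "cube_loop n Z z f" "C = hclass n Z z f"
  using assms by (auto simp: homotopy_group_def)

lemma induced_hom_hom:
  assumes "continuous_map Z W \<phi>" "\<phi> z = w" "0 < n"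
  shows "induced_hom n W w \<phi> \<in> hom (homotopy_group n Z z) (homotopy_group n W w)"
proof (rule homI)
  fix C assume "C \<in> carrier (homotopy_group n Z z)"
  then obtain f where f: "cube_loop n Z z f" "C = hclass n Z z f" by (rule homotopy_group_carrierE)
  then show "induced_hom n W w \<phi> C \<in> carrier (homotopy_group n W w)"
    using induced_hom_hclass[OF f(1) assms(1,2)] hclass_in_carrier by metis
next
  fix C D assume "C \<in> carrier (homotopy_group n Z z)" "D \<in> carrier (homotopy_group n Z z)"
  then obtain f g where f: "cube_loop n Z z f" "C = hclass n Z z f"
    and g: "cube_loop n Z z g" "D = hclass n Z z g" by (metis homotopy_group_carrierE)
  have comp: "\<phi> \<circ> cube_concat f g = cube_concat (\<phi> \<circ> f) (\<phi> \<circ> g)"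
    by (auto simp: cube_concat_def)
  note ind = induced_hom_hclass[OF _ assms(1,2)]
  show "induced_hom n W w \<phi> (C \<otimes>\<^bsub>homotopy_group n Z z\<^esub> D) =
        induced_hom n W w \<phi> C \<otimes>\<^bsub>homotopy_group n W w\<^esub> induced_hom n W w \<phi> D"
    using ind[OF f(1)] ind[OF g(1)] ind[OF cube_loop_concat[OF f(1) g(1) assms(3)]] assms(3)
    by (simp add: f g hclass_mult comp)
qed

text \<open>The straight line from \<open>e i\<close> to the identity in each coordinate stays in
  the cube, and keeps each face in itself because \<open>e i\<close> fixes 0 and 1.\<close>

lemma cube_homotopic_reparametrize:
  assumes f: "cube_loop n Z z f"
    and e: "\<And>i. i < n \<Longrightarrow> continuous_on {0..1} (e i)" "\<And>i. i < n \<Longrightarrow> e i 0 = 0" "\<And>i. i < n \<Longrightarrow> e i 1 = 1"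
      "\<And>i u. \<lbrakk>i < n; 0 \<le> u; u \<le> 1\<rbrakk> \<Longrightarrow> 0 \<le> e i u \<and> e i u \<le> (1::real)"
  shows "cube_homotopic n Z z (\<lambda>t. f (\<lambda>i\<in>{..<n}. e i (t i))) f"
proof (rule cube_homotopicI)
  let ?T = "homotopy_cube n"
  let ?F = "\<lambda>p. \<lambda>i\<in>{..<n}. (1 - fst p) * e i (snd p i) + fst p * snd p i"
  have c: "continuous_map ?T euclideanreal (\<lambda>p. snd p i)" if "i < n" for i
    by (rule continuous_map_cube_coord[OF continuous_map_homotopy_point that])
  have bd: "0 \<le> (1 - s) * e i (t i) + s * t i \<and> (1 - s) * e i (t i) + s * t i \<le> 1"
    if "i < n" "t \<in> topspace (cube n)" "0 \<le> s" "s \<le> 1" for i s t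
    using e(4)[OF that(1), of "t i"] cube_coord[OF that(2,1)] that
      convex_bound_le[of "e i (t i)" 1 "t i" "1 - s" s] by simp
  have F: "continuous_map ?T (cube n) ?F"
  proof (rule continuous_map_into_cube)
    fix i assume i: "i < n"
    have "continuous_map ?T (top_of_set {0..1}) (\<lambda>p. snd p i)"
      using c[OF i] cube_coord[of _ n i] i by (auto intro!: continuous_map_into_subtopology)
    from continuous_map_compose[OF this, of euclideanreal "e i"] e(1)[OF i]
    have "continuous_map ?T euclideanreal (\<lambda>p. e i (snd p i))" by (simp add: o_def)
    then show "continuous_map ?T euclideanreal (\<lambda>p. ?F p i)"
      using i c[OF i] by (simp, intro continuous_intros continuous_map_homotopy_param) auto
  qed (use bd in auto)
  show "continuous_map ?T Z (\<lambda>p. f (?F p))"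
    using continuous_map_compose[OF F conjunct1[OF f]] by (simp add: o_def)
  show "f (?F (1, t)) = f t" if "t \<in> topspace (cube n)" for t
  proof -
    have "?F (1, t) = t" using cube_ext[OF that] by (auto simp: extensional_def fun_eq_iff)
    then show ?thesis by simp
  qed
  show "f (?F (s, t)) = z" if st: "0 \<le> s" "s \<le> 1" "t \<in> cube_bdry n" for s t
  proof -
    obtain i where i: "i < n" "t i = 0 \<or> t i = 1" using st(3) by (auto simp: cube_bdry_def)
    have "?F (s, t) \<in> topspace (cube n)"
      using bd[OF _ cube_bdry_mem[OF st(3)] st(1,2)] by (intro cube_memI) auto
    then have "?F (s, t) \<in> cube_bdry n" using i e(2,3)[OF i(1)] by (intro cube_bdryI[of _ _ i]) auto
    then show ?thesis using f by blast
  qed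
qed auto

section \<open>Maps into the adjunction space\<close>

lemma istopology_disj_sum_top:
  fixes X :: "'a topology" and A :: "nat \<Rightarrow> 'b topology"
  shows "istopology (\<lambda>U. U \<subseteq> Inl ` topspace X \<union> (\<Union>j<k. (\<lambda>b. Inr (j, b)) ` topspace (A j))
      \<and> openin X {x. Inl x \<in> U} \<and> (\<forall>j<k. openin (A j) {b. Inr (j, b) \<in> U}))"
proof -
  have 1: "{x. Inl x \<in> S \<inter> T} = {x. Inl x \<in> S} \<inter> {x. Inl x \<in> T}" for S T :: "('a + nat \<times> 'b) set" by auto
  have 2: "{b. Inr (j, b) \<in> S \<inter> T} = {b. Inr (j, b) \<in> S} \<inter> {b. Inr (j, b) \<in> T}" for j and S T :: "('a + nat \<times> 'b) set" by auto
  have 3: "{x. Inl x \<in> \<Union>\<K>} = (\<Union>S\<in>\<K>. {x. Inl x \<in> S})" for \<K> :: "('a + nat \<times> 'b) set set" by auto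
  have 4: "{b. Inr (j, b) \<in> \<Union>\<K>} = (\<Union>S\<in>\<K>. {b. Inr (j, b) \<in> S})" for j and \<K> :: "('a + nat \<times> 'b) set set" by auto
  show ?thesis
    unfolding istopology_def 1 2 3 4 by (intro conjI allI impI openin_Int openin_Union; blast)
qed

lemma openin_disj_sum_top:
  "openin (disj_sum_top X A k) U \<longleftrightarrow> U \<subseteq> Inl ` topspace X \<union> (\<Union>j<k. (\<lambda>b. Inr (j, b)) ` topspace (A j))
      \<and> openin X {x. Inl x \<in> U} \<and> (\<forall>j<k. openin (A j) {b. Inr (j, b) \<in> U})"
  unfolding disj_sum_top_def topology_inverse'[OF istopology_disj_sum_top] ..

lemma topspace_disj_sum_top:
  "topspace (disj_sum_top X A k) = Inl ` topspace X \<union> (\<Union>j<k. (\<lambda>b. Inr (j, b)) ` topspace (A j))"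
proof -
  let ?S = "Inl ` topspace X \<union> (\<Union>j<k. (\<lambda>b. Inr (j, b)) ` topspace (A j))"
  have "{x. Inl x \<in> ?S} = topspace X" "\<And>j. j < k \<Longrightarrow> {b. Inr (j, b) \<in> ?S} = topspace (A j)" by auto
  then have "openin (disj_sum_top X A k) ?S" by (simp add: openin_disj_sum_top)
  moreover have "topspace (disj_sum_top X A k) \<subseteq> ?S"
    by (rule conjunct1[OF iffD1[OF openin_disj_sum_top openin_topspace]])
  ultimately show ?thesis using openin_subset by blast
qed

lemma istopology_quotient_top:
  "istopology (\<lambda>U. U \<subseteq> q ` topspace T \<and> openin T {x \<in> topspace T. q x \<in> U})"
proof -
  have 1: "{x \<in> topspace T. q x \<in> U \<inter> V} = {x \<in> topspace T. q x \<in> U} \<inter> {x \<in> topspace T. q x \<in> V}" for U V by auto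
  have 2: "{x \<in> topspace T. q x \<in> \<Union>\<K>} = (\<Union>U\<in>\<K>. {x \<in> topspace T. q x \<in> U})" for \<K> by auto
  show ?thesis unfolding istopology_def 1 2 by blast
qed

lemma openin_quotient_top:
  "openin (quotient_top T q) U \<longleftrightarrow> U \<subseteq> q ` topspace T \<and> openin T {x \<in> topspace T. q x \<in> U}"
  unfolding quotient_top_def topology_inverse'[OF istopology_quotient_top] ..

lemma quotient_map_quotient_top: "quotient_map T (quotient_top T q) q"
proof -
  have "{x \<in> topspace T. q x \<in> q ` topspace T} = topspace T" by auto
  then have "openin (quotient_top T q) (q ` topspace T)" by (simp add: openin_quotient_top)
  moreover have "topspace (quotient_top T q) \<subseteq> q ` topspace T"
    by (rule conjunct1[OF iffD1[OF openin_quotient_top openin_topspace]])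
  ultimately have "topspace (quotient_top T q) = q ` topspace T" using openin_subset by blast
  then show ?thesis by (auto simp: quotient_map_def openin_quotient_top)
qed

lemma continuous_map_from_adj_stage:
  assumes "continuous_map X W (\<lambda>p. f (Inl p))"
    and "\<And>j. j < k \<Longrightarrow> continuous_map (A j) W (\<lambda>b. f (adj_quot x a (Inr (j, b))))"
  shows "continuous_map (adj_stage X x A a k) W f"
proof -
  have "continuous_map (disj_sum_top X A k) W (f \<circ> adj_quot x a)"
    unfolding continuous_map_def
  proof (intro conjI allI impI)
    show "f \<circ> adj_quot x a \<in> topspace (disj_sum_top X A k) \<rightarrow> topspace W"
      using assms by (auto simp: topspace_disj_sum_top continuous_map_def Pi_iff adj_quot_def)
    fix U assume U: "openin W U"
    let ?V = "{p \<in> topspace (disj_sum_top X A k). (f \<circ> adj_quot x a) p \<in> U}"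
    have "{p. Inl p \<in> ?V} = {p \<in> topspace X. f (Inl p) \<in> U}"
      by (auto simp: topspace_disj_sum_top adj_quot_def)
    moreover have "openin X {p \<in> topspace X. f (Inl p) \<in> U}"
      by (rule openin_continuous_map_preimage[OF assms(1) U])
    ultimately have 1: "openin X {p. Inl p \<in> ?V}" by (rule ssubst)
    have 2: "openin (A j) {b. Inr (j, b) \<in> ?V}" if "j < k" for j
    proof -
      have "{b. Inr (j, b) \<in> ?V} = {b \<in> topspace (A j). f (adj_quot x a (Inr (j, b))) \<in> U}"
        using that by (auto simp: topspace_disj_sum_top)
      moreover have "openin (A j) {b \<in> topspace (A j). f (adj_quot x a (Inr (j, b))) \<in> U}"
        by (rule openin_continuous_map_preimage[OF assms(2)[OF that] U])
      ultimately show ?thesis by (rule ssubst)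
    qed
    have "?V \<subseteq> topspace (disj_sum_top X A k)" by (rule Collect_restrict)
    then show "openin (disj_sum_top X A k) ?V"
      unfolding openin_disj_sum_top topspace_disj_sum_top[symmetric] using 1 2 by blast
  qed
  then show ?thesis
    unfolding adj_stage_def by (rule continuous_compose_quotient_map[OF quotient_map_quotient_top])
qed

section \<open>Continuity of the retractions\<close>

lemma continuous_map_Adj_coord: "continuous_map (Adj X x A a) (adj_stage X x A a k) (\<lambda>y. y k)"
  unfolding Adj_def by (rule continuous_map_from_subtopology) (rule continuous_map_product_projection, simp)

lemma continuous_map_adj_r: "continuous_map (Adj X x A a) X adj_r"
proof -
  have "continuous_map (adj_stage X x A a 0) X projl"
    by (rule continuous_map_from_adj_stage) (auto simp: continuous_map_id[unfolded id_def])
  from continuous_map_compose[OF continuous_map_Adj_coord this] show ?thesis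
    by (simp add: adj_r_def[abs_def] o_def)
qed

lemma continuous_map_adj_rj:
  assumes "\<And>j. a j \<in> topspace (A j)"
  shows "continuous_map (Adj X x A a) (A j) (adj_rj a j)"
proof -
  let ?f = "\<lambda>p. case p of Inl _ \<Rightarrow> a j | Inr (i, b) \<Rightarrow> if i = j then b else a j"
  have "continuous_map (adj_stage X x A a (Suc j)) (A j) ?f"
  proof (rule continuous_map_from_adj_stage)
    fix i assume "i < Suc j"
    \<comment> \<open>On \<open>A j\<close> itself the composite is the identity even at
      \<open>a j\<close>, since the identified point goes back to \<open>a j\<close>; on the other
      pieces it is constant.\<close>
    have "(\<lambda>b. ?f (adj_quot x a (Inr (i, b)))) = (if i = j then id else (\<lambda>b. a j))"
      by (auto simp: adj_quot_def fun_eq_iff)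
    then show "continuous_map (A i) (A j) (\<lambda>b. ?f (adj_quot x a (Inr (i, b))))"
      using assms by simp
  qed (use assms in simp)
  from continuous_map_compose[OF continuous_map_Adj_coord this] show ?thesis
    by (simp add: adj_rj_def[abs_def] o_def)
qed

text \<open>The point of the inverse limit with retractions \<open>p\<close> in \<open>X\<close> and \<open>b j\<close> in \<open>A j\<close>; it is
  meaningful only when at most one \<open>b j\<close> differs from \<open>a j\<close>, and then \<open>p = x j\<close>.\<close>

definition adj_point :: "(nat \<Rightarrow> 'b) \<Rightarrow> 'a \<Rightarrow> (nat \<Rightarrow> 'b) \<Rightarrow> nat \<Rightarrow> 'a + nat \<times> 'b" where
  "adj_point a p b k = (if \<exists>j<k. b j \<noteq> a j then let j = (LEAST j. b j \<noteq> a j) in Inr (j, b j) else Inl p)"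

definition adj_compatible :: "(nat \<Rightarrow> 'a) \<Rightarrow> (nat \<Rightarrow> 'b) \<Rightarrow> 'a \<Rightarrow> (nat \<Rightarrow> 'b) \<Rightarrow> bool" where
  "adj_compatible x a p b \<longleftrightarrow> (\<forall>j. b j \<noteq> a j \<longrightarrow> p = x j \<and> (\<forall>i. b i \<noteq> a i \<longrightarrow> i = j))"

lemma adj_point_attached:
  assumes "adj_compatible x a p b" "b j \<noteq> a j"
  shows "adj_point a p b k = (if j < k then Inr (j, b j) else Inl p)"
proof -
  have *: "i = j" if "b i \<noteq> a i" for i using assms that by (auto simp: adj_compatible_def)
  have "(LEAST j. b j \<noteq> a j) = j"
    by (rule Least_equality) (use assms(2) in \<open>auto dest: *\<close>)
  moreover have "(\<exists>i<k. b i \<noteq> a i) \<longleftrightarrow> j < k" using * assms(2) by blast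
  ultimately show ?thesis by (simp add: adj_point_def)
qed

lemma adj_point_cases:
  assumes "adj_compatible x a p b"
  obtains (base) "\<And>j. j < k \<Longrightarrow> b j = a j" "adj_point a p b k = Inl p"
  | (attached) j where "j < k" "b j \<noteq> a j" "p = x j" "\<And>i. i \<noteq> j \<Longrightarrow> b i = a i" "adj_point a p b k = Inr (j, b j)"
proof (cases "\<exists>j<k. b j \<noteq> a j")
  case True
  then obtain j where j: "j < k" "b j \<noteq> a j" by blast
  then have "p = x j" "\<And>i. i \<noteq> j \<Longrightarrow> b i = a i" using assms by (auto simp: adj_compatible_def)
  then show thesis using attached j adj_point_attached[OF assms j(2), of k] by simp
next
  case False
  then have "adj_point a p b k = Inl p" unfolding adj_point_def by (rule if_not_P)
  with False show thesis using base by blast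
qed

lemma adj_r_point: "adj_r (adj_point a p b) = p"
  by (simp add: adj_r_def adj_point_def)

lemma adj_rj_point:
  assumes "adj_compatible x a p b"
  shows "adj_rj a j (adj_point a p b) = b j"
  using assms by (cases rule: adj_point_cases[where k = "Suc j"]) (auto simp: adj_rj_def)

lemma adj_point_base: "adj_point a p a = adj_incl p"
  by (simp add: adj_point_def adj_incl_def fun_eq_iff)

lemma adj_point_bond:
  assumes "adj_compatible x a p b"
  shows "adj_point a p b k = adj_bond x k (adj_point a p b (Suc k))"
  using assms
proof (cases rule: adj_point_cases[where k = "Suc k"])
  case base
  then have "\<not> (\<exists>j<k. b j \<noteq> a j)" by auto
  then have "adj_point a p b k = Inl p" unfolding adj_point_def by (rule if_not_P)
  then show ?thesis using base(2) by (simp add: adj_bond_def)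
next
  case (attached j)
  show ?thesis
    using adj_point_attached[OF assms attached(2), of k] attached(1,3,5)
    by (cases "j = k") (simp_all add: adj_bond_def)
qed

text \<open>The wedge topology agrees with the one induced from the product of the pieces, so
  continuity into the adjunction space can be checked after composing with the retractions.\<close>

proposition continuous_map_into_Adj:
  assumes H: "continuous_map T X H" and G: "\<And>j. continuous_map T (A j) (\<lambda>t. G t j)"
    and comp: "\<And>t. t \<in> topspace T \<Longrightarrow> adj_compatible x a (H t) (G t)"
    and a: "\<And>j. a j \<in> topspace (A j)" and x: "\<And>j. x j \<in> topspace X"
  shows "continuous_map T (Adj X x A a) (\<lambda>t. adj_point a (H t) (G t))"
proof -
  have HT: "H t \<in> topspace X" and GT: "G t j \<in> topspace (A j)" if "t \<in> topspace T" for t j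
    using that continuous_map_funspace[OF H] continuous_map_funspace[OF G[of j]] by auto
  have stage: "continuous_map T (adj_stage X x A a k) (\<lambda>t. adj_point a (H t) (G t) k)" for k
  proof -
    have top: "topspace (adj_stage X x A a k) = adj_quot x a ` topspace (disj_sum_top X A k)"
      unfolding adj_stage_def using quotient_map_quotient_top by (metis quotient_imp_surjective_map)
    have mem: "adj_point a (H t) (G t) k \<in> topspace (adj_stage X x A a k)" if t: "t \<in> topspace T" for t
      using comp[OF t]
    proof (cases rule: adj_point_cases[where k = k])
      case base
      then have "adj_point a (H t) (G t) k = adj_quot x a (Inl (H t))" by (simp add: adj_quot_def)
      moreover have "Inl (H t) \<in> topspace (disj_sum_top X A k)" using HT[OF t] by (simp add: topspace_disj_sum_top)
      ultimately show ?thesis using top by blast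
    next
      case (attached j)
      then have "adj_point a (H t) (G t) k = adj_quot x a (Inr (j, G t j))" by (simp add: adj_quot_def)
      moreover have "Inr (j, G t j) \<in> topspace (disj_sum_top X A k)"
        unfolding topspace_disj_sum_top using GT[OF t] attached(1) by blast
      ultimately show ?thesis using top by blast
    qed
    have "openin T {t \<in> topspace T. adj_point a (H t) (G t) k \<in> W}" if W: "openin (adj_stage X x A a k) W" for W
    proof -
      let ?W = "{p \<in> topspace (disj_sum_top X A k). adj_quot x a p \<in> W}"
      define U where "U = {p. Inl p \<in> ?W}"
      define V where "V = (\<lambda>j. {b. Inr (j, b) \<in> ?W})"
      have U: "openin X U" and V: "\<And>j. j < k \<Longrightarrow> openin (A j) (V j)"
        using W unfolding adj_stage_def openin_quotient_top openin_disj_sum_top U_def V_def by blast+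
      have memU: "p \<in> U \<longleftrightarrow> p \<in> topspace X \<and> Inl p \<in> W" for p
        by (auto simp: U_def topspace_disj_sum_top adj_quot_def)
      have memV: "b \<in> V j \<longleftrightarrow> b \<in> topspace (A j) \<and> (if b = a j then Inl (x j) \<in> W else Inr (j, b) \<in> W)" if "j < k" for b j
        using that by (auto simp: V_def topspace_disj_sum_top adj_quot_def)
      \<comment> \<open>\<open>V j\<close> contains \<open>a j\<close> exactly when
        \<open>x j\<close> lies in \<open>U\<close>. For \<open>j\<close> in \<open>?K\<close>,
        membership of \<open>G t j\<close> in \<open>V j\<close> therefore already says that the
        point sits in \<open>A j\<close> off the base point. The remaining points are those with
        \<open>H t\<close> in \<open>U\<close> and \<open>G t j\<close> in \<open>V j\<close> for
        all \<open>j\<close> in \<open>?J\<close>, a finite intersection because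
        \<open>j < k\<close>.\<close>
      let ?J = "{j. j < k \<and> x j \<in> U}" and ?K = "{j. j < k \<and> x j \<notin> U}"
      let ?O = "{t \<in> topspace T. H t \<in> U} \<inter> (\<Inter>j\<in>?J. {t \<in> topspace T. G t j \<in> V j})"
      have "{t \<in> topspace T. adj_point a (H t) (G t) k \<in> W} = ?O \<union> (\<Union>j\<in>?K. {t \<in> topspace T. G t j \<in> V j})"
        (is "?L = ?R")
      proof -
        have "t \<in> ?L \<longleftrightarrow> t \<in> ?R" if t: "t \<in> topspace T" for t
          using comp[OF t]
        proof (cases rule: adj_point_cases[where k = k])
          case base
          have "\<forall>i<k. (G t i \<in> V i) = (x i \<in> U)" using base(1) a x by (simp add: memU memV)
          moreover have "(H t \<in> U) = (adj_point a (H t) (G t) k \<in> W)" using base(2) HT[OF t] by (simp add: memU)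
          ultimately show ?thesis using t by blast
        next
          case (attached j)
          have "(G t i \<in> V i) = (x i \<in> U)" if "i < k" "i \<noteq> j" for i
            using attached(4)[OF that(2)] that(1) a x by (simp add: memU memV)
          then have "\<forall>i<k. i = j \<or> (G t i \<in> V i) = (x i \<in> U)" by blast
          moreover have "(G t j \<in> V j) = (adj_point a (H t) (G t) k \<in> W)"
            using attached(1,2,5) GT[OF t] by (simp add: memV)
          ultimately show ?thesis using t attached(1,3) by (cases "x j \<in> U") auto
        qed
        then show ?thesis by blast
      qed
      moreover have GV: "openin T {t \<in> topspace T. G t j \<in> V j}" if "j < k" for j
        by (rule openin_continuous_map_preimage[OF G V[OF that]])
      moreover have "openin T ?O"
      proof (cases "?J = {}")
        case True
        then show ?thesis using H U by (simp only: True) (simp add: openin_continuous_map_preimage)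
      next
        case False
        then show ?thesis
          using openin_continuous_map_preimage[OF H U] GV by (intro openin_Int openin_INT2) auto
      qed
      moreover have "openin T (\<Union>j\<in>?K. {t \<in> topspace T. G t j \<in> V j})"
        using GV by auto
      ultimately show ?thesis by (simp only:) (rule openin_Un)
    qed
    then show ?thesis using mem by (auto simp: continuous_map_def)
  qed
  then have "continuous_map T (product_topology (adj_stage X x A a) UNIV) (\<lambda>t. adj_point a (H t) (G t))"
    by (simp add: continuous_map_componentwise_UNIV)
  moreover from this have "adj_point a (H t) (G t) \<in> topspace (product_topology (adj_stage X x A a) UNIV)"
    if "t \<in> topspace T" for t
    using that by (auto simp: continuous_map_def Pi_iff)
  ultimately show ?thesis
    unfolding Adj_def using adj_point_bond[OF comp] by (auto intro!: continuous_map_into_subtopology)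
qed

section \<open>The splitting\<close>

definition clamp01 :: "real \<Rightarrow> real" where
  "clamp01 u = max 0 (min 1 u)"

text \<open>A trapezoid with plateau \<open>[1/8, 7/8]\<close>, which contains the box range
  \<open>[1/4, 3/4]\<close> and its two half-scale copies \<open>[1/8, 3/8]\<close> and
  \<open>[5/8, 7/8]\<close> arising from concatenation. Outside \<open>[0, 1]\<close> it is
  negative.\<close>

definition bump :: "real \<Rightarrow> real" where
  "bump u = min 1 (8 * min u (1 - u))"

lemma clamp01_bounds: "0 \<le> clamp01 u \<and> clamp01 u \<le> 1"
  by (simp add: clamp01_def)

lemma clamp01_eq: "u \<le> 0 \<Longrightarrow> clamp01 u = 0" "1 \<le> u \<Longrightarrow> clamp01 u = 1"
  by (simp_all add: clamp01_def)

lemma clamp01_interior: "0 < clamp01 u \<Longrightarrow> clamp01 u < 1 \<Longrightarrow> 0 < u \<and> u < 1"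
  by (auto simp: clamp01_def max_def min_def split: if_splits)

lemma bump_bounds: "\<lbrakk>0 \<le> u; u \<le> 1\<rbrakk> \<Longrightarrow> 0 \<le> bump u \<and> bump u \<le> 1"
  by (simp add: bump_def)

lemma bump_ends [simp]: "bump 0 = 0" "bump 1 = 0"
  by (simp_all add: bump_def)

lemma bump_middle: "\<lbrakk>1/8 \<le> u; u \<le> 7/8\<rbrakk> \<Longrightarrow> bump u = 1"
  by (simp add: bump_def min_def)

lemma continuous_map_clamp01:
  "continuous_map T euclideanreal u \<Longrightarrow> continuous_map T euclideanreal (\<lambda>p. clamp01 (u p))"
  unfolding clamp01_def by (intro continuous_intros) auto

lemma continuous_map_bump:
  "continuous_map T euclideanreal u \<Longrightarrow> continuous_map T euclideanreal (\<lambda>p. bump (u p))"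
  unfolding bump_def by (intro continuous_intros) auto

section \<open>Assembling maps on the pieces into one map\<close>

locale adj_section =
  fixes X :: "'a topology" and x :: "nat \<Rightarrow> 'a" and y0 :: 'a
    and A :: "nat \<Rightarrow> 'b topology" and a :: "nat \<Rightarrow> 'b" and n :: nat
    and \<beta> :: "real \<Rightarrow> 'a" and l r :: "nat \<Rightarrow> real"
  assumes y0_in: "y0 \<in> topspace X" and x_in: "\<And>j. x j \<in> topspace X" and a_in: "\<And>j. a j \<in> topspace (A j)"
    and n2: "2 \<le> n"
    and \<beta>_cont: "continuous_map (top_of_set {0..1}) X \<beta>" and \<beta>0: "\<beta> 0 = y0"
    and lr: "\<And>j. 0 \<le> l j \<and> l j < r j \<and> r j \<le> 1"
    and \<beta>_rest: "\<And>j t. \<lbrakk>l j < t; t < r j\<rbrakk> \<Longrightarrow> \<beta> t = x j"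
    and lr_sep: "\<And>i j. i \<noteq> j \<Longrightarrow> r i \<le> l j \<or> r j \<le> l i"
begin

text \<open>Coordinate 0 carries the concatenation and coordinate 1 the path \<open>\<beta>\<close>,
  so both must be coordinates of the cube.\<close>

lemma n_gt: "0 < n" "Suc 0 < n"
  using n2 by auto

text \<open>Direction 0 is left out: its damping enters \<open>base_map\<close> as the separate
  factor \<open>\<kappa>\<close>, which the homotopies vary.\<close>

definition side_bump :: "(nat \<Rightarrow> real) \<Rightarrow> real" where
  "side_bump t = (\<Prod>i\<in>{1..<n}. bump (t i))"

text \<open>Where the damping factors are 1, the path is run once while \<open>t 1\<close> goes from
  1/2 to 3/4. Towards the boundary \<open>\<kappa>\<close> and \<open>side_bump\<close> shrink its
  parameter to 0, hence its value to \<open>y0\<close>.\<close>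

definition base_map :: "((nat \<Rightarrow> real) \<Rightarrow> 'a) \<Rightarrow> real \<Rightarrow> (nat \<Rightarrow> real) \<Rightarrow> 'a" where
  "base_map f \<kappa> t = (if t 1 \<le> 1/2 then f (t(1 := 2 * t 1))
     else \<beta> (\<kappa> * side_bump t * clamp01 (4 * t 1 - 2)))"

text \<open>For \<open>i = 1\<close> this is the affine coordinate of the interval on which
  \<open>4 * u - 2\<close>, the path parameter, runs from \<open>l j\<close> to \<open>r j\<close>;
  in the other directions the box is the middle half \<open>[1/4, 3/4]\<close>.\<close>

definition box_coord :: "nat \<Rightarrow> nat \<Rightarrow> real \<Rightarrow> real" where
  "box_coord j i u = (if i = 1 then clamp01 ((4 * u - 2 - l j) / (r j - l j)) else clamp01 (2 * u - 1/2))"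

definition box_map :: "nat \<Rightarrow> real \<Rightarrow> (nat \<Rightarrow> real) \<Rightarrow> nat \<Rightarrow> real" where
  "box_map j v t = (\<lambda>i\<in>{..<n}. if i = 0 then v else box_coord j i (t i))"

definition combine :: "((nat \<Rightarrow> real) \<Rightarrow> 'a) \<Rightarrow> (nat \<Rightarrow> (nat \<Rightarrow> real) \<Rightarrow> 'b)
    \<Rightarrow> (nat \<Rightarrow> real) \<Rightarrow> (nat \<Rightarrow> 'a + nat \<times> 'b)" where
  "combine f g t = adj_point a (base_map f (bump (t 0)) t)
     (\<lambda>j. g j (box_map j (clamp01 (2 * t 0 - 1/2)) t))"

lemma side_bump_bounds:
  assumes "t \<in> topspace (cube n)"
  shows "0 \<le> side_bump t \<and> side_bump t \<le> 1"
proof -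
  have "0 \<le> bump (t i) \<and> bump (t i) \<le> 1" if "i \<in> {1..<n}" for i
    using cube_coord[OF assms, of i] that by (intro bump_bounds) auto
  then show ?thesis unfolding side_bump_def by (intro conjI prod_nonneg prod_le_1) blast+
qed

lemma box_coord_bounds: "0 \<le> box_coord j i u \<and> box_coord j i u \<le> 1"
  by (simp add: box_coord_def clamp01_bounds)

lemma box_coord_ends: "box_coord j i 0 = 0" "box_coord j i 1 = 1"
  using lr[of j] by (auto simp: box_coord_def clamp01_def max_def min_def field_simps)

lemma box_map_mem: "0 \<le> v \<and> v \<le> 1 \<Longrightarrow> box_map j v t \<in> topspace (cube n)"
  by (rule cube_memI) (auto simp: box_map_def box_coord_bounds)

lemma box_map_bdry:
  assumes "t \<in> cube_bdry n" "0 \<le> v \<and> v \<le> 1" "t 0 = 0 \<or> t 0 = 1 \<Longrightarrow> v = 0 \<or> v = 1"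
  shows "box_map j v t \<in> cube_bdry n"
proof -
  obtain i where "i < n" "t i = 0 \<or> t i = 1" using assms(1) by (auto simp: cube_bdry_def)
  then show ?thesis
    using assms(3) box_coord_ends by (intro cube_bdryI[OF box_map_mem[OF assms(2)], of i]) (auto simp: box_map_def)
qed

text \<open>On the path half a boundary point makes the parameter of \<open>\<beta>\<close> vanish:
  a face in direction 0 kills \<open>\<kappa>\<close>, any other face kills
  \<open>side_bump\<close>.\<close>

lemma base_map_bdry:
  assumes t: "t \<in> cube_bdry n" and f: "\<And>t. t \<in> cube_bdry n \<Longrightarrow> f t = y0" and "t 0 = 0 \<or> t 0 = 1 \<Longrightarrow> \<kappa> = 0"
  shows "base_map f \<kappa> t = y0"
proof (cases "t 1 \<le> 1/2")
  case True
  have "t(1 := 2 * t 1) \<in> cube_bdry n"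
    using t True cube_coord[OF cube_bdry_mem[OF t], of 1] n_gt by (intro cube_upd_bdry) auto
  then show ?thesis using True f by (simp add: base_map_def)
next
  case False
  obtain i where i: "i < n" "t i = 0 \<or> t i = 1" using t by (auto simp: cube_bdry_def)
  have "\<kappa> * side_bump t = 0"
  proof (cases "i = 0")
    case False
    then have "side_bump t = 0" unfolding side_bump_def using i by (intro prod_zero) (auto intro!: bexI[of _ i])
    then show ?thesis by simp
  qed (use i assms(3) in auto)
  then show ?thesis using False \<beta>0 by (simp only: base_map_def if_False mult_zero_left)
qed

text \<open>A value of \<open>g\<close> off the base point forces all box coordinates strictly
  between 0 and 1. This places \<open>t\<close> on the plateau of every side bump and the path
  parameter in the resting interval of \<open>j\<close>.\<close>

lemma box_map_support:
  assumes t: "t \<in> topspace (cube n)" and v: "0 \<le> v \<and> v \<le> 1"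
    and g: "\<And>t. t \<in> cube_bdry n \<Longrightarrow> g t = a j" and ne: "g (box_map j v t) \<noteq> a j"
  shows "0 < v" "v < 1" "l j < 4 * t 1 - 2" "4 * t 1 - 2 < r j" "base_map f 1 t = x j"
proof -
  have "box_map j v t \<notin> cube_bdry n" using g ne by blast
  then have "\<not> (box_map j v t i = 0 \<or> box_map j v t i = 1)" if "i < n" for i
    using cube_bdryI[OF box_map_mem[OF v] that] by blast
  moreover have "0 \<le> box_map j v t i \<and> box_map j v t i \<le> 1" if "i < n" for i
    using cube_coord[OF box_map_mem[OF v] that] .
  ultimately have int: "0 < box_map j v t i \<and> box_map j v t i < 1" if "i < n" for i
    using that by (metis order_le_less)
  show "0 < v" "v < 1" using int[of 0] n_gt by (auto simp: box_map_def)
  have "0 < (4 * t 1 - 2 - l j) / (r j - l j) \<and> (4 * t 1 - 2 - l j) / (r j - l j) < 1"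
    using int[of 1] n_gt clamp01_interior by (auto simp: box_map_def box_coord_def)
  then show lj: "l j < 4 * t 1 - 2" "4 * t 1 - 2 < r j" using lr[of j] by (auto simp: field_simps)
  have "bump (t i) = 1" if "i \<in> {1..<n}" for i
  proof (cases "i = 1")
    case True
    then show ?thesis using lj lr[of j] by (auto intro!: bump_middle)
  next
    case False
    then have "0 < clamp01 (2 * t i - 1/2)" "clamp01 (2 * t i - 1/2) < 1"
      using that int[of i] by (auto simp: box_map_def box_coord_def)
    then show ?thesis using clamp01_interior[of "2 * t i - 1/2"] by (auto intro!: bump_middle)
  qed
  then have "side_bump t = 1" by (simp add: side_bump_def)
  moreover have "clamp01 (4 * t 1 - 2) = 4 * t 1 - 2" using lj lr[of j] by (simp add: clamp01_def)
  moreover have "\<not> t 1 \<le> 1/2" using lj lr[of j] by simp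
  ultimately show "base_map f 1 t = x j" using \<beta>_rest[OF lj] by (simp add: base_map_def)
qed

text \<open>Only an interior \<open>v\<close> can produce a value off \<open>a j\<close>, and then
  \<open>\<kappa> = 1\<close> makes the base map rest at \<open>x j\<close>; the resting intervals
  being disjoint, at most one \<open>j\<close> is active. Leaving \<open>g\<close> and
  \<open>v\<close> existential lets the two factors of a concatenation be handled alike.\<close>

lemma adj_compatible_boxes:
  assumes t: "t \<in> topspace (cube n)"
    and b: "\<And>j. b j \<noteq> a j \<Longrightarrow> \<exists>g v. b j = g (box_map j v t) \<and> (\<forall>t\<in>cube_bdry n. g t = a j) \<and> 0 \<le> v \<and> v \<le> 1 \<and>
          (0 < v \<and> v < 1 \<longrightarrow> \<kappa> = 1)"
  shows "adj_compatible x a (base_map f \<kappa> t) b"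
proof -
  have *: "\<kappa> = 1 \<and> l j < 4 * t 1 - 2 \<and> 4 * t 1 - 2 < r j \<and> base_map f 1 t = x j" if bj: "b j \<noteq> a j" for j
  proof -
    obtain g v where gv: "b j = g (box_map j v t)" "\<And>t. t \<in> cube_bdry n \<Longrightarrow> g t = a j" "0 \<le> v \<and> v \<le> 1"
      "0 < v \<and> v < 1 \<longrightarrow> \<kappa> = 1" using b[OF bj] by blast
    then show ?thesis using box_map_support[OF t gv(3,2)] bj by auto
  qed
  have "i = j" if "b i \<noteq> a i" "b j \<noteq> a j" for i j
    using *[OF that(1)] *[OF that(2)] lr_sep[of i j] by linarith
  then show ?thesis using * unfolding adj_compatible_def by blast
qed

lemma continuous_map_base_map:
  assumes h: "continuous_map (homotopy_cube n) X h" "\<And>s t. \<lbrakk>0 \<le> s; s \<le> 1; t \<in> cube_bdry n\<rbrakk> \<Longrightarrow> h (s, t) = y0"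
    and \<kappa>: "continuous_map (homotopy_cube n) euclideanreal \<kappa>" "\<And>p. p \<in> topspace (homotopy_cube n) \<Longrightarrow> 0 \<le> \<kappa> p \<and> \<kappa> p \<le> 1"
  shows "continuous_map (homotopy_cube n) X (\<lambda>p. base_map (\<lambda>t. h (fst p, t)) (\<kappa> p) (snd p))"
proof -
  let ?T = "homotopy_cube n"
  have c: "continuous_map ?T euclideanreal (\<lambda>p. snd p i)" if "i < n" for i
    by (rule continuous_map_cube_coord[OF continuous_map_homotopy_point that])
  have c1: "continuous_map ?T euclideanreal (\<lambda>p. snd p 1)" using c[of 1] n_gt by simp
  have bd: "0 \<le> snd p 1 \<and> snd p 1 \<le> 1" if "p \<in> topspace ?T" for p
    using cube_coord[of "snd p" n 1] that n_gt by auto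
  let ?w = "\<lambda>p. \<kappa> p * side_bump (snd p) * clamp01 (4 * snd p 1 - 2)"
  have sb: "continuous_map ?T euclideanreal (\<lambda>p. side_bump (snd p))"
    unfolding side_bump_def by (intro continuous_map_prod continuous_map_bump c) auto
  have "continuous_map ?T euclideanreal (\<lambda>p. clamp01 (4 * snd p 1 - 2))"
    by (intro continuous_map_clamp01 continuous_intros c1) auto
  then have wc: "continuous_map ?T euclideanreal ?w"
    by (intro continuous_map_real_mult \<kappa> sb)
  have "0 \<le> ?w p \<and> ?w p \<le> 1" if "p \<in> topspace ?T" for p
    using \<kappa>(2)[OF that] side_bump_bounds[of "snd p"] clamp01_bounds[of "4 * snd p 1 - 2"] that
    by (auto intro!: mult_nonneg_nonneg mult_le_one)
  then have w: "continuous_map ?T (top_of_set {0..1}) ?w"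
    using wc by (auto simp: continuous_map_in_subtopology)
  have "continuous_map ?T X (\<lambda>p. if snd p 1 \<le> 1/2 then h (fst p, (snd p)(1 := 2 * snd p 1)) else \<beta> (?w p))"
  proof (rule continuous_map_cases_le[OF c1])
    show "continuous_map (subtopology ?T {p \<in> topspace ?T. snd p 1 \<le> 1/2}) X (\<lambda>p. h (fst p, (snd p)(1 := 2 * snd p 1)))"
    proof (rule continuous_map_homotopy_compose[OF h(1)])
      show "continuous_map (subtopology ?T {p \<in> topspace ?T. snd p 1 \<le> 1/2}) (cube n) (\<lambda>p. (snd p)(1 := 2 * snd p 1))"
        using n_gt by (intro continuous_map_cube_upd continuous_map_from_subtopology continuous_map_homotopy_point
          continuous_map_real_mult_left c1) (use bd in force)+
    qed (auto intro: continuous_map_from_subtopology continuous_map_homotopy_param)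
    show "continuous_map (subtopology ?T {p \<in> topspace ?T. 1/2 \<le> snd p 1}) X (\<lambda>p. \<beta> (?w p))"
      using continuous_map_from_subtopology[OF continuous_map_compose[OF w \<beta>_cont]] by (simp only: o_def)
    fix p assume p: "p \<in> topspace ?T" "snd p 1 = 1/2"
    then have "2 * snd p 1 = 1" and "(snd p)(1 := 1) \<in> cube_bdry n"
      using n_gt by (auto intro!: cube_bdryI[of _ _ 1] cube_upd_mem)
    moreover have "clamp01 (4 * snd p 1 - 2) = 0" using p by (simp add: clamp01_def)
    ultimately show "h (fst p, (snd p)(1 := 2 * snd p 1)) = \<beta> (?w p)"
      using p h(2)[of "fst p"] \<beta>0 by (auto simp: mem_Times_iff)
  qed simp
  then show ?thesis by (simp only: base_map_def)
qed

lemma continuous_on_box_coord: "continuous_on S (box_coord j i)"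
proof -
  have "r j - l j \<noteq> 0" using lr[of j] by simp
  then show ?thesis
    unfolding box_coord_def clamp01_def by (cases "i = 1") (auto intro!: continuous_intros)
qed

lemma continuous_map_box_map:
  assumes F: "continuous_map T (cube n) F" and v: "continuous_map T euclideanreal v" "\<And>p. p \<in> topspace T \<Longrightarrow> 0 \<le> v p \<and> v p \<le> 1"
  shows "continuous_map T (cube n) (\<lambda>p. box_map j (v p) (F p))"
proof (rule continuous_map_into_cube)
  fix i assume i: "i < n"
  have "continuous_map T euclideanreal (\<lambda>p. box_coord j i (F p i))"
    using continuous_map_compose[OF continuous_map_cube_coord[OF F i], of euclideanreal "box_coord j i"]
    by (simp add: o_def continuous_on_box_coord)
  then show "continuous_map T euclideanreal (\<lambda>p. box_map j (v p) (F p) i)"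
    using i v(1) by (cases "i = 0") (simp_all add: box_map_def)
qed (use v(2) in \<open>auto simp: box_map_def box_coord_bounds\<close>)

lemma homotopic_into_Adj:
  assumes "continuous_map (homotopy_cube n) X H" "\<And>j. continuous_map (homotopy_cube n) (A j) (\<lambda>p. G p j)"
    and "\<And>s t. \<lbrakk>0 \<le> s; s \<le> 1; t \<in> topspace (cube n)\<rbrakk> \<Longrightarrow> adj_compatible x a (H (s, t)) (G (s, t))"
    and "\<And>t. t \<in> topspace (cube n) \<Longrightarrow> f t = adj_point a (H (0, t)) (G (0, t))"
    and "\<And>t. t \<in> topspace (cube n) \<Longrightarrow> g t = adj_point a (H (1, t)) (G (1, t))"
    and "\<And>s t. \<lbrakk>0 \<le> s; s \<le> 1; t \<in> cube_bdry n\<rbrakk> \<Longrightarrow> H (s, t) = y0"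
    and "\<And>s t j. \<lbrakk>0 \<le> s; s \<le> 1; t \<in> cube_bdry n\<rbrakk> \<Longrightarrow> G (s, t) j = a j"
  shows "cube_homotopic n (Adj X x A a) (adj_incl y0) f g"
proof (rule cube_homotopicI)
  show "continuous_map (homotopy_cube n) (Adj X x A a) (\<lambda>p. adj_point a (H p) (G p))"
    using assms(1-3) a_in x_in by (intro continuous_map_into_Adj) auto
  show "adj_point a (H (s, t)) (G (s, t)) = adj_incl y0" if "0 \<le> s" "s \<le> 1" "t \<in> cube_bdry n" for s t
  proof -
    have "G (s, t) = a" using assms(7)[OF that] by (simp add: fun_eq_iff)
    then show ?thesis using assms(6)[OF that] adj_point_base by simp
  qed
qed (use assms(4,5) in auto)

text \<open>Replace \<open>f\<close> and the \<open>g j\<close> by their homotopies at time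
  \<open>s\<close>. The boxes and the damping do not depend on \<open>s\<close>, so compatibility
  persists, and the homotopies for all \<open>j\<close> run at once.\<close>

lemma combine_homotopic:
  assumes f: "cube_homotopic n X y0 f f'" and g: "\<And>j. cube_homotopic n (A j) (a j) (g j) (g' j)"
  shows "cube_homotopic n (Adj X x A a) (adj_incl y0) (combine f g) (combine f' g')"
proof -
  obtain h where h: "continuous_map (homotopy_cube n) X h" "\<And>t. h (0, t) = f t" "\<And>t. h (1, t) = f' t"
    "\<And>s t. \<lbrakk>0 \<le> s; s \<le> 1; t \<in> cube_bdry n\<rbrakk> \<Longrightarrow> h (s, t) = y0"
    using cube_homotopicE[OF f] by blast
  have "\<exists>k. continuous_map (homotopy_cube n) (A j) k \<and> (\<forall>t. k (0, t) = g j t) \<and> (\<forall>t. k (1, t) = g' j t) \<and>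
    (\<forall>s t. 0 \<le> s \<longrightarrow> s \<le> 1 \<longrightarrow> t \<in> cube_bdry n \<longrightarrow> k (s, t) = a j)" for j
    using cube_homotopicE[OF g[of j]] by metis
  then obtain k where k: "\<And>j. continuous_map (homotopy_cube n) (A j) (k j)" "\<And>j t. k j (0, t) = g j t" "\<And>j t. k j (1, t) = g' j t"
    "\<And>j s t. \<lbrakk>0 \<le> s; s \<le> 1; t \<in> cube_bdry n\<rbrakk> \<Longrightarrow> k j (s, t) = a j"
    by metis
  let ?T = "homotopy_cube n"
  let ?v = "\<lambda>t::nat\<Rightarrow>real. clamp01 (2 * t 0 - 1/2)"
  let ?H = "\<lambda>p. base_map (\<lambda>t. h (fst p, t)) (bump (snd p 0)) (snd p)"
  let ?G = "\<lambda>p j. k j (fst p, box_map j (?v (snd p)) (snd p))"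
  have c0: "continuous_map ?T euclideanreal (\<lambda>p. snd p 0)"
    by (rule continuous_map_cube_coord[OF continuous_map_homotopy_point n_gt(1)])
  show ?thesis
  proof (rule homotopic_into_Adj[of ?H ?G])
    show "continuous_map ?T X ?H"
      by (rule continuous_map_base_map[OF h(1,4) continuous_map_bump[OF c0]])
        (use cube_coord[of _ n 0] bump_bounds n_gt in auto)
    have v: "continuous_map ?T euclideanreal (\<lambda>p. ?v (snd p))"
      by (intro continuous_map_clamp01 continuous_intros c0) auto
    show "continuous_map ?T (A j) (\<lambda>p. ?G p j)" for j
      using clamp01_bounds by (intro continuous_map_homotopy_compose[OF k(1)] continuous_map_box_map v continuous_map_homotopy_cube) auto
    show "adj_compatible x a (?H (s, t)) (?G (s, t))" if "0 \<le> s" "s \<le> 1" "t \<in> topspace (cube n)" for s t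
    proof (rule adj_compatible_boxes)
      fix j
      have "bump (t 0) = 1" if "0 < ?v t \<and> ?v t < 1"
        using that clamp01_interior[of "2 * t 0 - 1/2"] by (intro bump_middle) auto
      then have "?G (s, t) j = (\<lambda>t. k j (s, t)) (box_map j (?v t) (snd (s, t))) \<and> (\<forall>t\<in>cube_bdry n. k j (s, t) = a j) \<and>
         0 \<le> ?v t \<and> ?v t \<le> 1 \<and> (0 < ?v t \<and> ?v t < 1 \<longrightarrow> bump (snd (s, t) 0) = 1)"
        using k(4) that clamp01_bounds by simp
      then show "\<exists>g v. ?G (s, t) j = g (box_map j v (snd (s, t))) \<and> (\<forall>t\<in>cube_bdry n. g t = a j) \<and>
         0 \<le> v \<and> v \<le> 1 \<and> (0 < v \<and> v < 1 \<longrightarrow> bump (snd (s, t) 0) = 1)"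
        by (intro exI[of _ "\<lambda>t. k j (s, t)"] exI[of _ "?v t"]) simp
    qed (use that in simp)
    show "?H (s, t) = y0" if "0 \<le> s" "s \<le> 1" "t \<in> cube_bdry n" for s t
      using that h(4) by (auto intro!: base_map_bdry)
    show "?G (s, t) j = a j" if "0 \<le> s" "s \<le> 1" "t \<in> cube_bdry n" for s t j
    proof -
      have "box_map j (?v t) t \<in> cube_bdry n"
        using that clamp01_bounds by (intro box_map_bdry) (auto simp: clamp01_def)
      then show ?thesis using k(4) that by simp
    qed
  qed (simp_all add: combine_def h k)
qed

lemma combine_loop:
  assumes "cube_loop n X y0 f" "\<And>j. cube_loop n (A j) (a j) (g j)"
  shows "cube_loop n (Adj X x A a) (adj_incl y0) (combine f g)"
  using combine_homotopic[of f f g g] assms by (simp only: homotopic_with_refl)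

text \<open>Concatenation rescales coordinate 0 only, while \<open>base_map\<close> rescales
  coordinate 1 and \<open>side_bump\<close> ignores coordinate 0; \<open>\<kappa>\<close> is passed
  on unchanged.\<close>

lemma base_map_concat:
  "base_map (cube_concat f f') \<kappa> t =
     (if t 0 \<le> 1/2 then base_map f \<kappa> (t(0 := 2 * t 0)) else base_map f' \<kappa> (t(0 := 2 * t 0 - 1)))"
proof -
  have "side_bump (t(0 := u)) = side_bump t" for u by (simp add: side_bump_def)
  moreover have "t(1 := v, 0 := u) = t(0 := u, 1 := v)" for u v by (simp add: fun_upd_twist)
  ultimately show ?thesis by (simp add: base_map_def cube_concat_def)
qed

lemma box_map_upd: "box_map j v (t(0 := u)) = box_map j v t" "(box_map j v t)(0 := u) = box_map j u t"
  using n_gt by (auto simp: box_map_def fun_eq_iff)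

lemma box_map_0: "box_map j v t 0 = v"
  using n_gt by (simp add: box_map_def)

lemma box_map_ends: "v = 0 \<or> v = 1 \<Longrightarrow> box_map j v t \<in> cube_bdry n"
  by (rule cube_bdryI[of _ _ 0]) (use n_gt box_map_0 in \<open>auto intro: box_map_mem\<close>)

text \<open>During the first half of the homotopy the wall \<open>t 0 = 1/2\<close>, where both factors sit at the
  base point, is lifted to the plateau of the path; during the second half the boxes of the two
  factors, which now lie over a common plateau, are pushed together.\<close>

lemma combine_concat:
  assumes f: "cube_loop n X y0 f" "cube_loop n X y0 f'"
    and g: "\<And>j. cube_loop n (A j) (a j) (g j)" "\<And>j. cube_loop n (A j) (a j) (g' j)"
  shows "cube_homotopic n (Adj X x A a) (adj_incl y0) (cube_concat (combine f g) (combine f' g'))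
     (combine (cube_concat f f') (\<lambda>j. cube_concat (g j) (g' j)))"
proof -
  \<comment> \<open>Up to \<open>s = 1/2\<close> this interpolates from the two separate bumps of
    the factors to one bump over the whole range, and then stays there.\<close>
  define \<kappa> :: "real \<Rightarrow> real \<Rightarrow> real" where
    "\<kappa> = (\<lambda>s u. (1 - min 1 (2 * s)) * max (bump (2 * u)) (bump (2 * u - 1)) + min 1 (2 * s) * bump u)"
  \<comment> \<open>With \<open>\<sigma> = max 0 (2 * s - 1)\<close> the first box occupies
    \<open>[(1 + \<sigma>)/8, (3 + \<sigma>)/8]\<close> and the second
    \<open>[(5 - \<sigma>)/8, (7 - \<sigma>)/8]\<close> in direction 0: they start as the half-scale
    copies and end side by side in \<open>[1/4, 3/4]\<close>.\<close>
  define v1 where "v1 = (\<lambda>s u. clamp01 (4 * u - (1 + max 0 (2 * s - 1)) / 2))"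
  define v2 where "v2 = (\<lambda>s u. clamp01 (4 * u - 5/2 + max 0 (2 * s - 1) / 2))"
  let ?T = "homotopy_cube n"
  let ?F = "cube_concat f f'"
  define H where "H = (\<lambda>p. base_map ?F (\<kappa> (fst p) (snd p 0)) (snd p))"
  define G where "G = (\<lambda>p j. if snd p 0 \<le> 1/2 then g j (box_map j (v1 (fst p) (snd p 0)) (snd p))
      else g' j (box_map j (v2 (fst p) (snd p 0)) (snd p)))"
  have gb: "\<And>j t. t \<in> cube_bdry n \<Longrightarrow> g j t = a j" "\<And>j t. t \<in> cube_bdry n \<Longrightarrow> g' j t = a j"
    using g by blast+
  have F: "cube_loop n X y0 ?F" by (rule cube_loop_concat[OF f n_gt(1)])
  have v_bounds: "0 \<le> v1 s u \<and> v1 s u \<le> 1" "0 \<le> v2 s u \<and> v2 s u \<le> 1" for s u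
    by (simp_all add: v1_def v2_def clamp01_bounds)
  have c0: "continuous_map ?T euclideanreal (\<lambda>p. snd p 0)"
    by (rule continuous_map_cube_coord[OF continuous_map_homotopy_point n_gt(1)])
  have c: "continuous_map ?T euclideanreal fst" by (rule continuous_map_homotopy_param)
  have coord: "0 \<le> t 0 \<and> t 0 \<le> 1" if "t \<in> topspace (cube n)" for t
    using cube_coord[OF that n_gt(1)] .
  have two_bumps: "max (bump (2 * u)) (bump (2 * u - 1)) = (if u \<le> 1/2 then bump (2 * u) else bump (2 * u - 1))"
    if "0 \<le> u" "u \<le> 1" for u
  proof (cases "u \<le> 1/2")
    case True
    then have "bump (2 * u - 1) \<le> 0" "0 \<le> bump (2 * u)" using that by (auto simp: bump_def)
    then show ?thesis using True by simp
  next
    case False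
    then have "bump (2 * u) \<le> 0" "0 \<le> bump (2 * u - 1)" using that by (auto simp: bump_def)
    then show ?thesis using False by simp
  qed
  have \<kappa>_bounds: "0 \<le> \<kappa> s u \<and> \<kappa> s u \<le> 1" if "0 \<le> u" "u \<le> 1" "0 \<le> s" for s u
  proof -
    have "0 \<le> max (bump (2 * u)) (bump (2 * u - 1)) \<and> max (bump (2 * u)) (bump (2 * u - 1)) \<le> 1"
      using that bump_bounds[of "2 * u"] bump_bounds[of "2 * u - 1"] unfolding two_bumps[OF that(1,2)] by auto
    then show ?thesis
      unfolding \<kappa>_def using that bump_bounds[of u]
        convex_bound_le[of "max (bump (2 * u)) (bump (2 * u - 1))" 1 "bump u" "1 - min 1 (2 * s)" "min 1 (2 * s)"]
      by (auto intro!: add_nonneg_nonneg mult_nonneg_nonneg)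
  qed
  have \<kappa>_cont: "continuous_map ?T euclideanreal (\<lambda>p. \<kappa> (fst p) (snd p 0))"
    unfolding \<kappa>_def by (intro continuous_intros continuous_map_bump c c0) auto
  have v_cont: "continuous_map ?T euclideanreal (\<lambda>p. v1 (fst p) (snd p 0))"
    "continuous_map ?T euclideanreal (\<lambda>p. v2 (fst p) (snd p 0))"
    unfolding v1_def v2_def by (intro continuous_map_clamp01 continuous_intros c c0; simp)+
  \<comment> \<open>Until \<open>s = 1/2\<close> the boxes have not moved and lie under both kinds
    of bump; afterwards only the single bump counts, whose plateau contains every position of the
    boxes.\<close>
  have \<kappa>1: "\<kappa> s u = 1" if "0 < v1 s u \<and> v1 s u < 1" "u \<le> 1/2" for s u
  proof -
    have u: "0 < 4 * u - (1 + max 0 (2 * s - 1)) / 2" "4 * u - (1 + max 0 (2 * s - 1)) / 2 < 1"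
      using that clamp01_interior unfolding v1_def by blast+
    then have "bump u = 1" using that by (intro bump_middle) auto
    show ?thesis
    proof (cases "s \<le> 1/2")
      case True
      then have "bump (2 * u) = 1" using u by (intro bump_middle) auto
      moreover have "bump (2 * u - 1) \<le> 1" by (simp add: bump_def)
      ultimately show ?thesis using \<open>bump u = 1\<close> by (simp add: \<kappa>_def)
    qed (use \<open>bump u = 1\<close> in \<open>simp add: \<kappa>_def\<close>)
  qed
  have \<kappa>2: "\<kappa> s u = 1" if "0 < v2 s u \<and> v2 s u < 1" "\<not> u \<le> 1/2" for s u
  proof -
    have u: "0 < 4 * u - 5/2 + max 0 (2 * s - 1) / 2" "4 * u - 5/2 + max 0 (2 * s - 1) / 2 < 1"
      using that clamp01_interior unfolding v2_def by blast+
    have "u \<le> 7/8" using u(2) by (auto simp: max_def field_simps split: if_splits)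
    then have "bump u = 1" using that by (intro bump_middle) auto
    show ?thesis
    proof (cases "s \<le> 1/2")
      case True
      then have "bump (2 * u - 1) = 1" using u by (intro bump_middle) auto
      moreover have "bump (2 * u) \<le> 1" by (simp add: bump_def)
      ultimately show ?thesis using \<open>bump u = 1\<close> by (simp add: \<kappa>_def)
    qed (use \<open>bump u = 1\<close> in \<open>simp add: \<kappa>_def\<close>)
  qed
  show ?thesis
  proof (rule homotopic_into_Adj[of H G])
    have "continuous_map ?T X (\<lambda>p. ?F (snd p))"
      using continuous_map_compose[OF continuous_map_homotopy_point conjunct1[OF F]] by (simp only: o_def)
    then show "continuous_map ?T X H"
      unfolding H_def using continuous_map_base_map[of "\<lambda>p. ?F (snd p)" "\<lambda>p. \<kappa> (fst p) (snd p 0)"] F \<kappa>_cont \<kappa>_bounds coord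
      by (simp add: image_subset_iff mem_Times_iff)
    show "continuous_map ?T (A j) (\<lambda>p. G p j)" for j
      unfolding G_def
    proof (rule continuous_map_cases_le[OF c0])
      have "continuous_map ?T (A j) (\<lambda>p. g j (box_map j (v1 (fst p) (snd p 0)) (snd p)))"
        using continuous_map_compose[OF continuous_map_box_map[OF continuous_map_homotopy_point v_cont(1) v_bounds(1)] conjunct1[OF g(1)]]
        by (simp only: o_def)
      then show "continuous_map (subtopology ?T {p \<in> topspace ?T. snd p 0 \<le> 1/2}) (A j) (\<lambda>p. g j (box_map j (v1 (fst p) (snd p 0)) (snd p)))"
        by (rule continuous_map_from_subtopology)
      have "continuous_map ?T (A j) (\<lambda>p. g' j (box_map j (v2 (fst p) (snd p 0)) (snd p)))"
        using continuous_map_compose[OF continuous_map_box_map[OF continuous_map_homotopy_point v_cont(2) v_bounds(2)] conjunct1[OF g(2)]]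
        by (simp only: o_def)
      then show "continuous_map (subtopology ?T {p \<in> topspace ?T. 1/2 \<le> snd p 0}) (A j) (\<lambda>p. g' j (box_map j (v2 (fst p) (snd p 0)) (snd p)))"
        by (rule continuous_map_from_subtopology)
      \<comment> \<open>The wall is at or past the right end of the first box and at or before the
        left end of the second, so both factors take boundary values.\<close>
      fix p assume p: "p \<in> topspace ?T" "snd p 0 = 1/2"
      then have "v1 (fst p) (snd p 0) = 1" "v2 (fst p) (snd p 0) = 0"
        unfolding v1_def v2_def
        by (intro clamp01_eq; auto simp: mem_Times_iff max_def field_simps)+
      then show "g j (box_map j (v1 (fst p) (snd p 0)) (snd p)) = g' j (box_map j (v2 (fst p) (snd p 0)) (snd p))"
        using gb box_map_ends by simp
    qed simp
    show "adj_compatible x a (H (s, t)) (G (s, t))" if st: "0 \<le> s" "s \<le> 1" "t \<in> topspace (cube n)" for s t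
      unfolding H_def fst_conv snd_conv
    proof (rule adj_compatible_boxes[OF st(3)])
      fix j
      show "\<exists>ga v. G (s, t) j = ga (box_map j v t) \<and> (\<forall>t\<in>cube_bdry n. ga t = a j) \<and> 0 \<le> v \<and> v \<le> 1 \<and>
          (0 < v \<and> v < 1 \<longrightarrow> \<kappa> s (t 0) = 1)"
      proof (cases "t 0 \<le> 1/2")
        case True
        then show ?thesis using gb v_bounds \<kappa>1
          by (intro exI[of _ "g j"] exI[of _ "v1 s (t 0)"]) (simp add: G_def)
      next
        case False
        then show ?thesis using gb v_bounds \<kappa>2
          by (intro exI[of _ "g' j"] exI[of _ "v2 s (t 0)"]) (simp add: G_def)
      qed
    qed
    show "cube_concat (combine f g) (combine f' g') t = adj_point a (H (0, t)) (G (0, t))"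
      if t: "t \<in> topspace (cube n)" for t
    proof -
      have "\<kappa> 0 (t 0) = (if t 0 \<le> 1/2 then bump (2 * t 0) else bump (2 * t 0 - 1))"
        using two_bumps coord[OF t] by (simp add: \<kappa>_def)
      moreover have "v1 0 u = clamp01 (2 * (2 * u) - 1/2)" "v2 0 u = clamp01 (2 * (2 * u - 1) - 1/2)" for u
        by (simp_all add: v1_def v2_def)
      ultimately show ?thesis
        by (cases "t 0 \<le> 1/2") (simp_all add: cube_concat_def[of "combine f g"] combine_def H_def G_def base_map_concat box_map_upd)
    qed
    show "combine ?F (\<lambda>j. cube_concat (g j) (g' j)) t = adj_point a (H (1, t)) (G (1, t))"
      if t: "t \<in> topspace (cube n)" for t
    proof -
      let ?v = "clamp01 (2 * t 0 - 1/2)"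
      have "\<kappa> 1 (t 0) = bump (t 0)" by (simp add: \<kappa>_def)
      \<comment> \<open>At time 1 the two boxes abut at 1/2 and together form one standard box cut
        in the middle: doubling its clamped coordinate gives \<open>v1\<close>, or \<open>v2\<close>
        after subtracting 1.\<close>
      moreover have "cube_concat (g j) (g' j) (box_map j ?v t) = G (1, t) j" for j
      proof (cases "t 0 \<le> 1/2")
        case True
        then have "?v \<le> 1/2" "2 * ?v = v1 1 (t 0)" by (auto simp: v1_def clamp01_def max_def min_def)
        then show ?thesis using True by (simp add: cube_concat_def box_map_0 box_map_upd G_def)
      next
        case False
        then have "\<not> ?v \<le> 1/2" "2 * ?v - 1 = v2 1 (t 0)" by (auto simp: v2_def clamp01_def max_def min_def)
        then show ?thesis using False by (simp add: cube_concat_def box_map_0 box_map_upd G_def)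
      qed
      ultimately show ?thesis by (simp add: combine_def H_def)
    qed
    show "H (s, t) = y0" if "0 \<le> s" "s \<le> 1" "t \<in> cube_bdry n" for s t
    proof -
      have "\<kappa> s (t 0) = 0" if "t 0 = 0 \<or> t 0 = 1" using that by (auto simp: \<kappa>_def bump_def)
      then show ?thesis unfolding H_def using that F by (auto intro!: base_map_bdry)
    qed
    show "G (s, t) j = a j" if st: "0 \<le> s" "s \<le> 1" "t \<in> cube_bdry n" for s t j
    proof (cases "t 0 \<le> 1/2")
      case True
      have "v1 s (t 0) = 0" if "t 0 = 0 \<or> t 0 = 1"
        unfolding v1_def by (rule clamp01_eq) (use that True in \<open>auto simp: max_def field_simps\<close>)
      then have "box_map j (v1 s (t 0)) t \<in> cube_bdry n"
        using st v_bounds by (intro box_map_bdry) auto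
      then show ?thesis using True gb by (simp add: G_def)
    next
      case False
      have "v2 s (t 0) = 1" if "t 0 = 0 \<or> t 0 = 1"
        unfolding v2_def by (rule clamp01_eq) (use that False in \<open>auto simp: max_def field_simps\<close>)
      then have "box_map j (v2 s (t 0)) t \<in> cube_bdry n"
        using st v_bounds by (intro box_map_bdry) auto
      then show ?thesis using False gb by (simp add: G_def)
    qed
  qed
qed

section \<open>Composites of the combined map with the retractions\<close>

lemma combine_compatible:
  assumes "\<And>j. cube_loop n (A j) (a j) (g j)" "t \<in> topspace (cube n)"
  shows "adj_compatible x a (base_map f (bump (t 0)) t) (\<lambda>j. g j (box_map j (clamp01 (2 * t 0 - 1/2)) t))"
proof (rule adj_compatible_boxes[OF assms(2)])
  fix j
  have "bump (t 0) = 1" if "0 < clamp01 (2 * t 0 - 1/2) \<and> clamp01 (2 * t 0 - 1/2) < 1"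
    using that clamp01_interior[of "2 * t 0 - 1/2"] by (intro bump_middle) auto
  then show "\<exists>ga v. g j (box_map j (clamp01 (2 * t 0 - 1/2)) t) = ga (box_map j v t) \<and> (\<forall>t\<in>cube_bdry n. ga t = a j) \<and>
      0 \<le> v \<and> v \<le> 1 \<and> (0 < v \<and> v < 1 \<longrightarrow> bump (t 0) = 1)"
    using assms(1)[of j] clamp01_bounds
    by (intro exI[of _ "g j"] exI[of _ "clamp01 (2 * t 0 - 1/2)"]) (simp add: image_subset_iff)
qed

text \<open>Composing with the retraction leaves \<open>g j\<close> after a coordinatewise
  reparametrization fixing 0 and 1; the clamp in direction 0 is
  \<open>box_coord j 0\<close>.\<close>

lemma adj_rj_combine:
  assumes g: "\<And>j. cube_loop n (A j) (a j) (g j)"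
  shows "cube_homotopic n (A j) (a j) (adj_rj a j \<circ> combine f g) (g j)"
proof (rule cube_homotopic_eq)
  show "cube_homotopic n (A j) (a j) (\<lambda>t. g j (\<lambda>i\<in>{..<n}. box_coord j i (t i))) (g j)"
    using continuous_on_box_coord box_coord_ends box_coord_bounds by (intro cube_homotopic_reparametrize g)
  fix t assume t: "t \<in> topspace (cube n)"
  have "box_map j (clamp01 (2 * t 0 - 1/2)) t = (\<lambda>i\<in>{..<n}. box_coord j i (t i))"
    by (auto simp: box_map_def box_coord_def fun_eq_iff)
  then show "(adj_rj a j \<circ> combine f g) t = g j (\<lambda>i\<in>{..<n}. box_coord j i (t i))"
    using adj_rj_point[OF combine_compatible[OF g t]] by (simp add: combine_def)
qed

text \<open>Letting \<open>\<kappa>\<close> go to 0 retracts the detour along \<open>\<beta>\<close>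
  to \<open>y0\<close>; what remains is \<open>f\<close> on half of the cube, a reparametrization of
  \<open>f\<close> in direction 1.\<close>

lemma adj_r_combine:
  assumes f: "cube_loop n X y0 f"
  shows "cube_homotopic n X y0 (adj_r \<circ> combine f g) f"
proof -
  let ?T = "homotopy_cube n"
  have c0: "continuous_map ?T euclideanreal (\<lambda>p. snd p 0)"
    by (rule continuous_map_cube_coord[OF continuous_map_homotopy_point n_gt(1)])
  have fb: "\<And>t. t \<in> cube_bdry n \<Longrightarrow> f t = y0" using f by blast
  have 1: "cube_homotopic n X y0 (adj_r \<circ> combine f g) (base_map f 0)"
  proof (rule cube_homotopicI)
    have "continuous_map ?T X (\<lambda>p. f (snd p))"
      using continuous_map_compose[OF continuous_map_homotopy_point conjunct1[OF f]] by (simp only: o_def)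
    moreover have "continuous_map ?T euclideanreal (\<lambda>p. (1 - fst p) * bump (snd p 0))"
      by (intro continuous_intros continuous_map_bump c0 continuous_map_homotopy_param) auto
    moreover have "0 \<le> (1 - fst p) * bump (snd p 0) \<and> (1 - fst p) * bump (snd p 0) \<le> 1" if "p \<in> topspace ?T" for p
      using that cube_coord[of "snd p" n 0] n_gt bump_bounds[of "snd p 0"] by (auto intro!: mult_le_one)
    ultimately show "continuous_map ?T X (\<lambda>p. base_map f ((1 - fst p) * bump (snd p 0)) (snd p))"
      using continuous_map_base_map[of "\<lambda>p. f (snd p)" "\<lambda>p. (1 - fst p) * bump (snd p 0)"] fb by simp
  qed (use fb in \<open>auto simp: combine_def adj_r_point intro!: base_map_bdry\<close>)
  define e :: "nat \<Rightarrow> real \<Rightarrow> real" where "e = (\<lambda>i u. if i = 1 then min 1 (2 * u) else u)"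
  have 2: "cube_homotopic n X y0 (base_map f 0) f"
  proof (rule cube_homotopic_eq)
    show "cube_homotopic n X y0 (\<lambda>t. f (\<lambda>i\<in>{..<n}. e i (t i))) f"
    proof (rule cube_homotopic_reparametrize[OF f])
      show "continuous_on {0..1} (e i)" for i
        unfolding e_def by (cases "i = 1") (auto intro!: continuous_intros)
    qed (auto simp: e_def)
    fix t assume t: "t \<in> topspace (cube n)"
    have e: "(\<lambda>i\<in>{..<n}. e i (t i)) = t(1 := min 1 (2 * t 1))"
      using cube_ext[OF t] n_gt by (auto simp: e_def fun_eq_iff extensional_def)
    show "base_map f 0 t = f (\<lambda>i\<in>{..<n}. e i (t i))"
    proof (cases "t 1 \<le> 1/2")
      case True
      then have "min 1 (2 * t 1) = 2 * t 1" by simp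
      then show ?thesis unfolding e base_map_def using True by (simp only: if_True)
    next
      case False
      have "t(1 := 1) \<in> cube_bdry n" using t n_gt by (intro cube_bdryI[of _ _ 1] cube_upd_mem) auto
      moreover have "min 1 (2 * t 1) = 1" using False by simp
      ultimately show ?thesis unfolding e base_map_def using False fb \<beta>0 by simp
    qed
  qed
  show ?thesis by (rule homotopic_with_trans[OF 1 2])
qed

end

section \<open>The homomorphism and its right inverse\<close>

theorem theorem3p12:
  fixes X :: "'a topology" and x :: "nat \<Rightarrow> 'a" and y0 :: 'a
    and A :: "nat \<Rightarrow> 'b topology" and a :: "nat \<Rightarrow> 'b" and n :: nat
  assumes "peano_continuum X"
    and "y0 \<in> topspace X"
    and "\<And>j. x j \<in> topspace X"
    and "\<And>j. Hausdorff_space (A j)"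
    and "\<And>j. a j \<in> topspace (A j)"
    and "n \<ge> 2"
  shows "adj_Psi n X y0 A a \<in> hom (homotopy_group n (Adj X x A a) (adj_incl y0))
           (homotopy_group n X y0 \<times>\<times> product_group UNIV (\<lambda>j. homotopy_group n (A j) (a j)))
       \<and> (\<exists>s \<in> hom (homotopy_group n X y0 \<times>\<times> product_group UNIV (\<lambda>j. homotopy_group n (A j) (a j)))
                    (homotopy_group n (Adj X x A a) (adj_incl y0)).
            \<forall>g \<in> carrier (homotopy_group n X y0 \<times>\<times> product_group UNIV (\<lambda>j. homotopy_group n (A j) (a j))).
              adj_Psi n X y0 A a (s g) = g)"
proof -
  let ?Y = "Adj X x A a" and ?y = "adj_incl y0 :: nat \<Rightarrow> 'a + nat \<times> 'b"
  let ?\<pi>Y = "homotopy_group n ?Y ?y" and ?\<pi>X = "homotopy_group n X y0"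
  let ?\<pi>A = "\<lambda>j. homotopy_group n (A j) (a j)"
  let ?P = "?\<pi>X \<times>\<times> product_group UNIV ?\<pi>A"
  have n0: "0 < n" using assms(6) by simp
  have r: "continuous_map ?Y X adj_r" "adj_r ?y = y0"
    by (rule continuous_map_adj_r) (simp add: adj_r_def adj_incl_def)
  have rj: "continuous_map ?Y (A j) (adj_rj a j)" "adj_rj a j ?y = a j" for j
    by (rule continuous_map_adj_rj[OF assms(5)]) (simp add: adj_rj_def adj_incl_def)
  have homX: "induced_hom n X y0 adj_r \<in> hom ?\<pi>Y ?\<pi>X"
    by (rule induced_hom_hom) (use r n0 in auto)
  have homA: "induced_hom n (A j) (a j) (adj_rj a j) \<in> hom ?\<pi>Y (?\<pi>A j)" for j
    by (rule induced_hom_hom) (use rj n0 in auto)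
  have Psi: "adj_Psi n X y0 A a \<in> hom ?\<pi>Y ?P"
    by (rule homI) (simp_all add: adj_Psi_def hom_in_carrier[OF homX] hom_in_carrier[OF homA]
        hom_mult[OF homX] hom_mult[OF homA] PiE_UNIV_domain restrict_UNIV)
  have X: "metrizable_space X" "compact_space X" "connected_space X" "locally_path_connected_space X"
    using assms(1) by (simp_all add: peano_continuum_def)
  obtain \<beta> and l r :: "nat \<Rightarrow> real" where path: "continuous_map (top_of_set {0..1}) X \<beta>" "\<beta> 0 = y0"
    "\<And>j. 0 \<le> l j \<and> l j < r j \<and> r j \<le> 1"
    "\<And>j t. \<lbrakk>l j < t; t < r j\<rbrakk> \<Longrightarrow> \<beta> t = x j" "\<And>i j. i \<noteq> j \<Longrightarrow> r i \<le> l j \<or> r j \<le> l i"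
    by (rule path_resting_at_sequence[where x = x, OF X assms(2,3)], rule that) assumption+
  interpret adj_section X x y0 A a n \<beta> l r
    by unfold_locales (use assms path in auto)
  \<comment> \<open>Representatives are chosen in all factors at once;
    \<open>combine_homotopic\<close> makes the resulting class independent of the choice.\<close>
  define s where "s = (\<lambda>(C, D). hclass n ?Y ?y (combine (SOME f. f \<in> C) (\<lambda>j. SOME g. g \<in> D j)))"
  have s_hclass: "s (hclass n X y0 f, \<lambda>j. hclass n (A j) (a j) (g j)) = hclass n ?Y ?y (combine f g)"
    if "cube_loop n X y0 f" "\<And>j. cube_loop n (A j) (a j) (g j)" for f g
    unfolding s_def prod.case
    by (rule hclass_eqI[OF combine_homotopic[OF hclass_rep_homotopic[OF that(1)] hclass_rep_homotopic[OF that(2)]], symmetric])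
  have repr: "\<exists>f g. cube_loop n X y0 f \<and> (\<forall>j. cube_loop n (A j) (a j) (g j)) \<and>
      c = (hclass n X y0 f, \<lambda>j. hclass n (A j) (a j) (g j))" if P: "c \<in> carrier ?P" for c
  proof -
    obtain C D where c: "c = (C, D)" "C \<in> carrier ?\<pi>X" "\<And>j. D j \<in> carrier (?\<pi>A j)"
      using P by (cases c) (auto simp: PiE_UNIV_domain)
    show ?thesis
      unfolding c(1)
    proof (intro exI conjI allI)
      show "(C, D) = (hclass n X y0 (SOME f. f \<in> C), \<lambda>j. hclass n (A j) (a j) (SOME g. g \<in> D j))"
        by (simp only: homotopy_group_rep(2)[OF c(2)] homotopy_group_rep(2)[OF c(3)])
    qed (use homotopy_group_rep(1)[OF c(2)] homotopy_group_rep(1)[OF c(3)] in blast)+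
  qed
  have "s \<in> hom ?P ?\<pi>Y"
  proof (rule homI)
    fix c assume "c \<in> carrier ?P"
    from repr[OF this] obtain f g where c: "cube_loop n X y0 f" "\<And>j. cube_loop n (A j) (a j) (g j)"
      "c = (hclass n X y0 f, \<lambda>j. hclass n (A j) (a j) (g j))"
      by blast
    show "s c \<in> carrier ?\<pi>Y" unfolding c(3) s_hclass[OF c(1,2)] by (rule hclass_in_carrier[OF combine_loop[OF c(1,2)]])
  next
    fix c c' assume reps: "c \<in> carrier ?P" "c' \<in> carrier ?P"
    from repr[OF reps(1)] obtain f g where
      c: "cube_loop n X y0 f" "\<And>j. cube_loop n (A j) (a j) (g j)" "c = (hclass n X y0 f, \<lambda>j. hclass n (A j) (a j) (g j))"
      by blast
    from repr[OF reps(2)] obtain f' g' where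
      c': "cube_loop n X y0 f'" "\<And>j. cube_loop n (A j) (a j) (g' j)" "c' = (hclass n X y0 f', \<lambda>j. hclass n (A j) (a j) (g' j))"
      by blast
    have "c \<otimes>\<^bsub>?P\<^esub> c' = (hclass n X y0 (cube_concat f f'), \<lambda>j. hclass n (A j) (a j) (cube_concat (g j) (g' j)))"
      by (simp add: c(3) c'(3) hclass_mult[OF c(1) c'(1) n0] hclass_mult[OF c(2) c'(2) n0] restrict_UNIV)
    then have "s (c \<otimes>\<^bsub>?P\<^esub> c') = hclass n ?Y ?y (combine (cube_concat f f') (\<lambda>j. cube_concat (g j) (g' j)))"
      using s_hclass[OF cube_loop_concat[OF c(1) c'(1) n0] cube_loop_concat[OF c(2) c'(2) n0]] by simp
    \<comment> \<open>Multiplicativity rests on the homotopy that merges the pairs of boxes for all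
      \<open>j\<close> at once.\<close>
    also have "\<dots> = hclass n ?Y ?y (cube_concat (combine f g) (combine f' g'))"
      by (rule sym, rule hclass_eqI, rule combine_concat[OF c(1) c'(1) c(2) c'(2)])
    also have "\<dots> = s c \<otimes>\<^bsub>?\<pi>Y\<^esub> s c'"
      using hclass_mult[OF combine_loop[OF c(1,2)] combine_loop[OF c'(1,2)] n0]
      by (simp add: c(3) c'(3) s_hclass[OF c(1,2)] s_hclass[OF c'(1,2)])
    finally show "s (c \<otimes>\<^bsub>?P\<^esub> c') = s c \<otimes>\<^bsub>?\<pi>Y\<^esub> s c'" .
  qed
  moreover have "adj_Psi n X y0 A a (s c) = c" if P: "c \<in> carrier ?P" for c
  proof -
    obtain f g where c: "cube_loop n X y0 f" "\<And>j. cube_loop n (A j) (a j) (g j)"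
      "c = (hclass n X y0 f, \<lambda>j. hclass n (A j) (a j) (g j))"
      using repr[OF P] by blast
    note loop = combine_loop[OF c(1,2)]
    have sc: "s c = hclass n ?Y ?y (combine f g)" unfolding c(3) by (rule s_hclass[OF c(1,2)])
    have "induced_hom n X y0 adj_r (s c) = hclass n X y0 f"
      unfolding sc induced_hom_hclass(2)[where \<phi> = adj_r, OF loop r] by (rule hclass_eqI[OF adj_r_combine[OF c(1)]])
    moreover have "induced_hom n (A j) (a j) (adj_rj a j) (s c) = hclass n (A j) (a j) (g j)" for j
      unfolding sc induced_hom_hclass(2)[where \<phi> = "adj_rj a j", OF loop rj] by (rule hclass_eqI[OF adj_rj_combine[OF c(2)]])
    ultimately show ?thesis by (simp add: adj_Psi_def c(3))
  qed
  ultimately show ?thesis using Psi by blast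
qed

end
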